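(* Let $\Omega=\Omega_1\times\cdots\times\Omega_d\subseteq\mathbb{R}^d$ with $\mu(\Omega)<\infty$, let $\vec p=(p_1,\dots,p_d)$ with $0<p_i\le\infty$ for all $i$ and $p_{\min}:=\min\{p_1,\dots,p_d\}<\infty$, and let $0<q\le\infty$. Let $\varepsilon>0$ be sufficiently small, let $\varkappa$ be a positive monotonically decreasing function on $(0,\varepsilon]$, and let $0<v\le\infty$. Then $$\left(\int_0^\varepsilon\left[\varkappa(t)\,t^{1/p_{\min}}f^*(t)\right]^v\frac{dt}{t}\right)^{1/v}\le c\,\|f\|_{L_{\vec p,q}}$$ holds for some $c>0$ and all $f\in L_{\vec p,q}(\Omega)$ if, and only if, $\varkappa$ is bounded on $(0,\varepsilon]$ and $q\le v\le\infty$, where for $v=\infty$ the inequality is to be read as $$\sup_{0<t<\varepsilon}\varkappa(t)\,t^{1/p_{\min}}f^*(t)\le c\,\|f\|_{L_{\vec p,q}}.\qquad( * )$$ In particular, if $\varkappa$ is an arbitrary non-negative function on $(0,\varepsilon]$, then $( * )$ holds (for some $c>0$ and all $f\in L_{\vec p,q}(\Omega)$) if, and only if, $\varkappa$ is bounded.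
   Context: Setting: $\Omega_1,\dots,\Omega_d\subseteq\mathbb{R}$ are Lebesgue measurable sets of positive measure, $\Omega=\prod_i\Omega_i$, and $\mu$ is Lebesgue measure on $\Omega$. "Sufficiently small" means $0<\varepsilon\le\varepsilon_0$ for some $\varepsilon_0>0$ depending only on $\Omega$, $\vec p$ and $q$. Mixed Lebesgue quasi-norm: for measurable $f:\Omega\to\mathbb{R}$, $$\|f\|_{\vec p}=\left(\int_{\Omega_d}\cdots\left(\int_{\Omega_1}|f(x_1,\dots,x_d)|^{p_1}\,dx_1\right)^{p_2/p_1}\cdots\,dx_d\right)^{1/p_d},$$ i.e. one takes the $L_{p_1}$ quasi-norm in $x_1$, then the $L_{p_2}$ quasi-norm in $x_2$, etc., with the essential supremum in $x_j$ if $p_j=\infty$. Mixed Lorentz space: $L_{\vec p,q}(\Omega)$ consists of the measurable $f$ with finite quasi-norm $$\|f\|_{L_{\vec p,q}}=\left(\int_0^\infty u^q\,\|\chi_{\{|f|>u\}}\|_{\vec p}^q\,\frac{du}{u}\right)^{1/q}\ (0<q<\infty),\qquad \|f\|_{L_{\vec p,\infty}}=\sup_{u>0}u\,\|\chi_{\{|f|>u\}}\|_{\vec p},$$ where $\chi_A$ denotes the characteristic function of $A$. Rearrangement: $f^*(t)=\inf\{s>0:\mu(\{|f|>s\})\le t\}$, $t\ge0$ (with $\inf\emptyset=\infty$). *)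

theory Defs
  imports "HOL-Analysis.Analysis" "HOL-Probability.Essential_Supremum"
begin

text \<open>
  A point of the d-dimensional space is an extensional function on \<open>{..<d}\<close>; the mathematical
  coordinate \<open>x\<^sub>j\<close> is \<open>x (j - 1)\<close>, and likewise for the sets \<open>\<Omega>\<^sub>j\<close> and the exponents \<open>p\<^sub>j\<close>.
  Exponents range over \<open>(0,\<infinity>]\<close> and are therefore extended nonnegative reals.
\<close>

definition prod_set :: "nat \<Rightarrow> (nat \<Rightarrow> real set) \<Rightarrow> (nat \<Rightarrow> real) set" where
  "prod_set d \<Omega> = PiE {..<d} \<Omega>"

definition lebesgue_prod :: "nat \<Rightarrow> (nat \<Rightarrow> real set) \<Rightarrow> (nat \<Rightarrow> real) measure" where
  "lebesgue_prod d \<Omega> = restrict_space (completion (PiM {..<d} (\<lambda>_. lborel))) (prod_set d \<Omega>)"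

text \<open>Only used for \<open>a > 0\<close>, where it is the continuous extension of the real power.\<close>

definition epowr :: "ennreal \<Rightarrow> real \<Rightarrow> ennreal" where
  "epowr x a = (if x = \<infinity> then \<infinity> else ennreal (enn2real x powr a))"

definition Lp_qnorm :: "'a measure \<Rightarrow> ennreal \<Rightarrow> ('a \<Rightarrow> ennreal) \<Rightarrow> ennreal" where
  "Lp_qnorm M p g =
     (if p = \<infinity> then esssup M g
      else epowr (\<integral>\<^sup>+ x. epowr (g x) (enn2real p) \<partial>M) (1 / enn2real p))"

text \<open>
  \<open>iter_qnorm \<Omega> p k g x\<close> is the value at \<open>x\<close> after the quasi-norms in the first \<open>k\<close> variables have
  been taken, the first variable innermost; it does not depend on \<open>x 0, \<dots>, x (k - 1)\<close>.
  For a Lebesgue measurable \<open>g\<close>, sections that fail to be measurable occur only over null sets, so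
  the values that the integral and \<^const>\<open>esssup\<close> take on non-measurable functions are irrelevant.
\<close>

primrec iter_qnorm ::
  "(nat \<Rightarrow> real set) \<Rightarrow> (nat \<Rightarrow> ennreal) \<Rightarrow> nat \<Rightarrow> ((nat \<Rightarrow> real) \<Rightarrow> ennreal) \<Rightarrow> (nat \<Rightarrow> real) \<Rightarrow> ennreal"
where
  "iter_qnorm \<Omega> p 0 g x = g x"
| "iter_qnorm \<Omega> p (Suc k) g x =
     Lp_qnorm (lebesgue_on (\<Omega> k)) (p k) (\<lambda>t. iter_qnorm \<Omega> p k g (x(k := t)))"

text \<open>
  Starting from the constantly \<^const>\<open>undefined\<close> function, the \<open>d\<close> updates produce exactly the
  extensional functions, i.e. the points of \<^term>\<open>prod_set d \<Omega>\<close>.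
\<close>

definition mixed_qnorm ::
  "nat \<Rightarrow> (nat \<Rightarrow> real set) \<Rightarrow> (nat \<Rightarrow> ennreal) \<Rightarrow> ((nat \<Rightarrow> real) \<Rightarrow> real) \<Rightarrow> ennreal" where
  "mixed_qnorm d \<Omega> p f = iter_qnorm \<Omega> p d (\<lambda>x. ennreal \<bar>f x\<bar>) (\<lambda>_. undefined)"

definition lorentz_qnorm ::
  "nat \<Rightarrow> (nat \<Rightarrow> real set) \<Rightarrow> (nat \<Rightarrow> ennreal) \<Rightarrow> ennreal \<Rightarrow> ((nat \<Rightarrow> real) \<Rightarrow> real) \<Rightarrow> ennreal" where
  "lorentz_qnorm d \<Omega> p q f =
     (let N = (\<lambda>u. mixed_qnorm d \<Omega> p (indicator {x \<in> prod_set d \<Omega>. \<bar>f x\<bar> > u})) in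
      if q = \<infinity> then (SUP u\<in>{0<..}. ennreal u * N u)
      else epowr (\<integral>\<^sup>+ u\<in>{0<..}. ennreal (u powr enn2real q) * epowr (N u) (enn2real q)
                      * ennreal (1 / u) \<partial>lborel) (1 / enn2real q))"

definition lorentz_space ::
  "nat \<Rightarrow> (nat \<Rightarrow> real set) \<Rightarrow> (nat \<Rightarrow> ennreal) \<Rightarrow> ennreal \<Rightarrow> ((nat \<Rightarrow> real) \<Rightarrow> real) set" where
  "lorentz_space d \<Omega> p q =
     {f \<in> borel_measurable (lebesgue_prod d \<Omega>). lorentz_qnorm d \<Omega> p q f < \<infinity>}"

definition rearrangement :: "'a measure \<Rightarrow> ('a \<Rightarrow> real) \<Rightarrow> real \<Rightarrow> ennreal" where
  "rearrangement M f t =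
     Inf {ennreal s | s. s > 0 \<and> emeasure M {x \<in> space M. \<bar>f x\<bar> > s} \<le> ennreal t}"

definition p_min :: "nat \<Rightarrow> (nat \<Rightarrow> ennreal) \<Rightarrow> ennreal" where
  "p_min d p = Min (p ` {..<d})"

text \<open>
  The left-hand side \<open>(\<integral>\<^sub>0\<^sup>\<epsilon> [\<kappa>(t) t\<^sup>1\<^sup>/\<^sup>r f\<^sup>*(t)]\<^sup>v dt/t)\<^sup>1\<^sup>/\<^sup>v\<close> with \<open>r < \<infinity>\<close>, and the supremum over
  \<open>0 < t < \<epsilon>\<close> for \<open>v = \<infinity>\<close>. Only values of \<open>\<kappa>\<close> on \<open>(0,\<epsilon>)\<close> enter; they are nonnegative in all uses.
\<close>

definition weighted_rearr ::
  "'a measure \<Rightarrow> ennreal \<Rightarrow> real \<Rightarrow> (real \<Rightarrow> real) \<Rightarrow> ennreal \<Rightarrow> ('a \<Rightarrow> real) \<Rightarrow> ennreal" where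
  "weighted_rearr M r \<epsilon> \<kappa> v f =
     (let h = (\<lambda>t. ennreal (\<kappa> t * t powr (1 / enn2real r)) * rearrangement M f t) in
      if v = \<infinity> then (SUP t\<in>{0<..<\<epsilon>}. h t)
      else epowr (\<integral>\<^sup>+ t\<in>{0<..<\<epsilon>}. epowr (h t) (enn2real v) * ennreal (1 / t) \<partial>lborel)
             (1 / enn2real v))"

definition rearr_inequality ::
  "nat \<Rightarrow> (nat \<Rightarrow> real set) \<Rightarrow> (nat \<Rightarrow> ennreal) \<Rightarrow> ennreal \<Rightarrow> real \<Rightarrow> (real \<Rightarrow> real) \<Rightarrow> ennreal \<Rightarrow> bool" where
  "rearr_inequality d \<Omega> p q \<epsilon> \<kappa> v \<longleftrightarrow>
     (\<exists>c::real. c > 0 \<and> (\<forall>f\<in>lorentz_space d \<Omega> p q.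
        weighted_rearr (lebesgue_prod d \<Omega>) (p_min d p) \<epsilon> \<kappa> v f \<le> ennreal c * lorentz_qnorm d \<Omega> p q f))"

end

theory Submission
  imports Defs
begin

text \<open>
  Write \<open>r\<close> for the least exponent and \<open>D u\<close> for the measure of \<open>{|f| > u}\<close>. On a product of finite
  measure, applying the embedding \<open>L\<^sub>p \<subseteq> L\<^sub>r\<close> in one variable at a time gives
  \<open>(\<mu> A)\<^sup>1\<^sup>/\<^sup>r \<le> C \<parallel>\<chi>\<^sub>A\<parallel>\<close>. Hence the classical Lorentz functional of \<open>u \<mapsto> (D u)\<^sup>1\<^sup>/\<^sup>r\<close> is at most a
  multiple of the mixed one, and for bounded \<open>\<kappa>\<close> the inequality reduces to the embedding
  of \<open>L\<^sub>r\<^sub>,\<^sub>q\<close> into \<open>L\<^sub>r\<^sub>,\<^sub>v\<close>, via the layer-cake formula for \<open>f\<^sup>*\<close>.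

  Conversely, let only the coordinate with the exponent \<open>r\<close> vary. This gives nested boxes of measure
  \<open>L s\<close> whose indicators have quasi-norm at most \<open>K s\<^sup>1\<^sup>/\<^sup>r\<close>. Their indicators force \<open>\<kappa>\<close> to be bounded,
  and truncations of the function that behaves like \<open>s\<^sup>-\<^sup>1\<^sup>/\<^sup>r\<close> on them force \<open>q \<le> v\<close>: the
  left-hand side grows like \<open>X\<^sup>1\<^sup>/\<^sup>v\<close> and the right-hand side like \<open>X\<^sup>1\<^sup>/\<^sup>q\<close> in the logarithm \<open>X\<close> of
  the truncation height.
\<close>

section \<open>Extended powers and elementary integrals\<close>

text \<open>Superlevel sets of \<open>f\<close> are measurable only for the completed product
  measure, so sections of such a set, and with them its iterated quasi-norms, may fail to be
  measurable. The lower bound therefore compares two different functions: the iterated integral of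
  the indicator of a Borel part of the same measure, whose sections are all measurable, and the
  iterated quasi-norm of the whole set, about which only pointwise inequalities are used. For the
  same reason constants are moved to the measurable side before integrating.

  The constants of the nested boxes are fixed before the weight and \<open>v\<close>, and they
  determine the range of \<epsilon>. To bound f* from below at t it suffices to have a box of
  measure 2t, which asks for 2t < L c; the doubling supplies the strict inequality between t and the
  measure of a superlevel set. A finite \<open>v\<close> tests the weight only on average: a large
  value at \<tau> is detected because monotonicity keeps the weight large on all of (0, \<tau>).
  Monotonicity also turns the value at \<epsilon> into a positive lower bound, through which the
  logarithmic growth becomes visible.\<close>

lemma epowr_ennreal: "0 \<le> y \<Longrightarrow> epowr (ennreal y) a = ennreal (y powr a)"
  by (simp add: epowr_def)

lemma epowr_top [simp]: "epowr \<infinity> a = \<infinity>" "epowr top a = \<infinity>"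
  by (simp_all add: epowr_def)

lemma epowr_0 [simp]: "epowr 0 a = 0"
  by (simp add: epowr_def)

lemma epowr_one [simp]: "epowr 1 a = 1"
  by (simp add: epowr_def)

lemma epowr_1 [simp]: "epowr x 1 = x"
  by (cases x) (auto simp: epowr_ennreal)

lemma epowr_mono: "x \<le> y \<Longrightarrow> 0 \<le> a \<Longrightarrow> epowr x a \<le> epowr y a"
  by (cases x; cases y) (auto simp: epowr_ennreal powr_mono2 ennreal_leI top_unique)

lemma epowr_mult: "0 < a \<Longrightarrow> epowr (x * y) a = epowr x a * epowr y a"
proof (cases x; cases y)
  fix u assume a: "0 < a" and "x = top" "y = ennreal u" "0 \<le> u"
  then show ?thesis by (cases "u = 0") (auto simp: epowr_ennreal ennreal_top_mult ennreal_mult_top)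
next
  fix u assume a: "0 < a" and "y = top" "x = ennreal u" "0 \<le> u"
  then show ?thesis by (cases "u = 0") (auto simp: epowr_ennreal ennreal_top_mult ennreal_mult_top)
qed (auto simp: epowr_ennreal powr_mult simp flip: ennreal_mult)

lemma epowr_epowr: "epowr (epowr x a) b = epowr x (a * b)"
  by (cases x) (auto simp: epowr_ennreal powr_powr)

lemma epowr_add: "0 < a \<Longrightarrow> 0 < b \<Longrightarrow> epowr x (a + b) = epowr x a * epowr x b"
  by (cases x) (auto simp: epowr_ennreal powr_add ennreal_mult)

lemma epowr_inverse [simp]:
  "a \<noteq> 0 \<Longrightarrow> epowr (epowr x a) (1 / a) = x"
  "a \<noteq> 0 \<Longrightarrow> epowr (epowr x (1 / a)) a = x"
  by (simp_all add: epowr_epowr)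

lemma epowr_eq_0_iff [simp]: "epowr x a = 0 \<longleftrightarrow> x = 0"
  by (cases x) (auto simp: epowr_ennreal)

lemma epowr_eq_top_iff [simp]: "epowr x a = top \<longleftrightarrow> x = top"
  by (cases x) (auto simp: epowr_ennreal)

lemma borel_measurable_epowr [measurable (raw)]:
  assumes [measurable]: "f \<in> borel_measurable M"
  shows "(\<lambda>x. epowr (f x) a) \<in> borel_measurable M"
  unfolding epowr_def by measurable

lemma nn_integral_powr_from_0:
  assumes "0 < a" "0 \<le> c"
  shows "(\<integral>\<^sup>+ t\<in>{0<..<c}. ennreal (t powr (a - 1)) \<partial>lborel) = ennreal (c powr a / a)"
proof -
  have "((\<lambda>x. x powr (a - 1)) has_integral (c powr (a - 1 + 1) / (a - 1 + 1))) {0..c}"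
    using assms by (intro has_integral_powr_from_0) auto
  then have "(\<integral>\<^sup>+ t. ennreal (t powr (a - 1)) * indicator {0..c} t \<partial>lborel) = ennreal (c powr a / a)"
    by (intro nn_integral_has_integral_lebesgue'[where f = "\<lambda>x. x powr (a-1)"]) (auto)
  moreover have "(\<integral>\<^sup>+ t. ennreal (t powr (a - 1)) * indicator {0..c} t \<partial>lborel) =
    (\<integral>\<^sup>+ t\<in>{0<..<c}. ennreal (t powr (a - 1)) \<partial>lborel)"
    by (intro nn_integral_cong_AE)
      (use AE_lborel_singleton[of c] in eventually_elim, auto split: split_indicator)
  ultimately show ?thesis by simp
qed

lemma nn_integral_inverse:
  assumes "0 < a" "a \<le> b"
  shows "(\<integral>\<^sup>+ t\<in>{a<..<b}. ennreal (1 / t) \<partial>lborel) = ennreal (ln (b / a))"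
proof -
  have "(\<integral>\<^sup>+ t. ennreal (1 / t) * indicator {a..b} t \<partial>lborel) = ennreal (ln b - ln a)"
    using assms by (intro nn_integral_FTC_Icc)
      (auto intro!: has_real_derivative_iff_has_vector_derivative[THEN iffD1]
        has_field_derivative_at_within DERIV_ln_divide)
  moreover have "(\<integral>\<^sup>+ t. ennreal (1 / t) * indicator {a..b} t \<partial>lborel) =
    (\<integral>\<^sup>+ t\<in>{a<..<b}. ennreal (1 / t) \<partial>lborel)"
    by (intro nn_integral_cong_AE)
      (use AE_lborel_singleton[of a] AE_lborel_singleton[of b] in eventually_elim, auto split: split_indicator)
  ultimately show ?thesis using assms by (simp add: ln_div)
qed

section \<open>Quasi-norms of sets from below\<close>

text \<open>Splitting at the height l = \<open>\<Lambda>\<close> takes the place of Hoelder's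
  inequality: w^r is at most l^r where w <= l, and at most l^(r-P) w^P elsewhere. After integration
  the first bound yields the measure of the space and the second, by the hypothesis on the
  \<open>P\<close>-th powers, the summand 1.\<close>

lemma nn_integral_epowr_mono_exponent:
  fixes w :: "'a \<Rightarrow> ennreal"
  assumes w [measurable]: "w \<in> borel_measurable M"
    and r: "0 < r" "r \<le> P"
    and le: "(\<integral>\<^sup>+ x. epowr (w x) P \<partial>M) \<le> epowr \<Lambda> P"
  shows "(\<integral>\<^sup>+ x. epowr (w x) r \<partial>M) \<le> epowr \<Lambda> r * (emeasure M (space M) + 1)"
proof -
  consider "\<Lambda> = 0" | "\<Lambda> = top" | l where "\<Lambda> = ennreal l" "0 < l"
    by (cases \<Lambda>) (auto simp: less_le)
  then show ?thesis
  proof cases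
    case 1
    then have "(\<integral>\<^sup>+ x. epowr (w x) P \<partial>M) = 0" using le by simp
    then have "AE x in M. epowr (w x) P = 0" by (simp add: nn_integral_0_iff_AE)
    then have "(\<integral>\<^sup>+ x. epowr (w x) r \<partial>M) = (\<integral>\<^sup>+ x. 0 \<partial>M)"
      by (intro nn_integral_cong_AE) auto
    then show ?thesis by simp
  next
    case 2
    then show ?thesis by (auto simp: ennreal_top_mult)
  next
    case 3
    have "epowr (w x) r \<le> ennreal (l powr r) + ennreal (l powr (r - P)) * epowr (w x) P" for x
    proof (cases "w x")
      case (real y)
      have "y powr r \<le> l powr r + l powr (r - P) * y powr P"
      proof (cases "y \<le> l")
        case True
        then have "y powr r \<le> l powr r" using real r by (intro powr_mono2) auto
        then show ?thesis by (simp add: add_increasing2)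
      next
        case False
        then have "y powr (r - P) \<le> l powr (r - P)" using 3 r by (intro powr_mono2') auto
        then have "y powr (r - P) * y powr P \<le> l powr (r - P) * y powr P"
          by (intro mult_right_mono) auto
        then have "y powr r \<le> l powr (r - P) * y powr P" by (simp flip: powr_add)
        then show ?thesis by (simp add: add_increasing)
      qed
      then show ?thesis using real 3
        by (simp add: epowr_ennreal ennreal_leI flip: ennreal_mult ennreal_plus)
    qed (use 3 in \<open>auto simp: ennreal_mult_top\<close>)
    then have "(\<integral>\<^sup>+ x. epowr (w x) r \<partial>M) \<le>
      (\<integral>\<^sup>+ x. ennreal (l powr r) + ennreal (l powr (r - P)) * epowr (w x) P \<partial>M)"
      by (intro nn_integral_mono)
    also have "\<dots> = ennreal (l powr r) * emeasure M (space M) +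
        ennreal (l powr (r - P)) * (\<integral>\<^sup>+ x. epowr (w x) P \<partial>M)"
      by (simp add: nn_integral_add nn_integral_cmult)
    also have "\<dots> \<le> ennreal (l powr r) * emeasure M (space M) + ennreal (l powr (r - P)) * epowr \<Lambda> P"
      by (intro add_left_mono mult_left_mono le) auto
    also have "ennreal (l powr (r - P)) * epowr \<Lambda> P = ennreal (l powr r)"
      using 3 by (simp add: epowr_ennreal flip: ennreal_mult powr_add)
    finally show ?thesis using 3 by (simp add: epowr_ennreal distrib_left)
  qed
qed

text \<open>Only \<open>g\<close> has to be measurable: this is applied with \<open>h\<close> an iterated quasi-norm of a set
  whose sections need not all be measurable.\<close>

lemma Lp_qnorm_lower_bound:
  fixes g h :: "'a \<Rightarrow> ennreal"
  assumes g [measurable]: "g \<in> borel_measurable M"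
    and r: "0 < r" "ennreal r \<le> p"
    and C: "0 < C"
    and le: "\<And>x. x \<in> space M \<Longrightarrow> epowr (g x) (1 / r) \<le> ennreal C * h x"
  shows "epowr (\<integral>\<^sup>+ x. g x \<partial>M) (1 / r) \<le>
    ennreal C * epowr (emeasure M (space M) + 1) (1 / r) * Lp_qnorm M p h"
proof -
  define w where "w = (\<lambda>x. epowr (g x) (1 / r))"
  have w [measurable]: "w \<in> borel_measurable M" unfolding w_def by measurable
  have g_eq: "g x = epowr (w x) r" for x using r by (simp add: w_def)
  let ?\<Lambda> = "ennreal C * Lp_qnorm M p h"
  have "(\<integral>\<^sup>+ x. epowr (w x) r \<partial>M) \<le> epowr ?\<Lambda> r * (emeasure M (space M) + 1)"
  proof (cases "p = \<infinity>")
    case True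
    have "AE x in M. epowr (w x) r \<le> epowr ?\<Lambda> r"
      using esssup_AE[of h M] AE_space
    proof eventually_elim
      case (elim x)
      have "w x \<le> ennreal C * h x" using le elim by (simp add: w_def)
      also have "\<dots> \<le> ?\<Lambda>" using elim True by (auto simp: Lp_qnorm_def intro!: mult_left_mono)
      finally show ?case using r by (intro epowr_mono) auto
    qed
    then have "(\<integral>\<^sup>+ x. epowr (w x) r \<partial>M) \<le> (\<integral>\<^sup>+ x. epowr ?\<Lambda> r \<partial>M)"
      by (rule nn_integral_mono_AE)
    also have "\<dots> = epowr ?\<Lambda> r * emeasure M (space M)" by simp
    also have "\<dots> \<le> epowr ?\<Lambda> r * (emeasure M (space M) + 1)" by (intro mult_left_mono) auto
    finally show ?thesis .
  next
    case False
    then obtain P where P: "p = ennreal P" "0 \<le> P" by (cases p) auto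
    then have rP: "r \<le> P" using r by simp
    \<comment> \<open>The constant is divided out on the left, because it can be pulled out of the
      integral of the measurable \<open>w\<close> but not out of that of \<open>h\<close>.\<close>
    have "ennreal (1 / C) * w x \<le> h x" if "x \<in> space M" for x
    proof -
      have "ennreal (1 / C) * w x \<le> ennreal (1 / C) * (ennreal C * h x)"
        using le[OF that] by (intro mult_left_mono) (auto simp: w_def)
      also have "\<dots> = h x" using C by (simp flip: ennreal_mult mult.assoc)
      finally show ?thesis .
    qed
    then have "(\<integral>\<^sup>+ x. epowr (ennreal (1 / C) * w x) P \<partial>M) \<le> (\<integral>\<^sup>+ x. epowr (h x) P \<partial>M)"
      using P by (intro nn_integral_mono epowr_mono) auto
    moreover have "(\<integral>\<^sup>+ x. epowr (ennreal (1 / C) * w x) P \<partial>M) =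
      ennreal ((1 / C) powr P) * (\<integral>\<^sup>+ x. epowr (w x) P \<partial>M)"
      using rP r C by (simp add: epowr_mult epowr_ennreal nn_integral_cmult)
    ultimately have "ennreal (C powr P) * (ennreal ((1 / C) powr P) * (\<integral>\<^sup>+ x. epowr (w x) P \<partial>M)) \<le>
      ennreal (C powr P) * (\<integral>\<^sup>+ x. epowr (h x) P \<partial>M)"
      by (intro mult_left_mono) auto
    moreover have "ennreal (C powr P) * (ennreal ((1 / C) powr P) * I) = I" for I
      using C by (simp add: powr_divide flip: ennreal_mult mult.assoc)
    moreover have "ennreal (C powr P) * (\<integral>\<^sup>+ x. epowr (h x) P \<partial>M) = epowr ?\<Lambda> P"
      using P r rP C by (simp add: Lp_qnorm_def epowr_mult epowr_ennreal)
    ultimately show ?thesis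
      by (intro nn_integral_epowr_mono_exponent[OF w r(1) rP]) simp
  qed
  then have "epowr (\<integral>\<^sup>+ x. epowr (w x) r \<partial>M) (1 / r) \<le>
      epowr (epowr ?\<Lambda> r * (emeasure M (space M) + 1)) (1 / r)"
    using r by (intro epowr_mono) auto
  also have "\<dots> = ?\<Lambda> * epowr (emeasure M (space M) + 1) (1 / r)"
    using r by (simp add: epowr_mult)
  finally show ?thesis by (simp add: g_eq mult_ac)
qed

section \<open>The completed product measure\<close>

interpretation lborel_prod: product_sigma_finite "\<lambda>_::nat. lborel :: real measure"
  by standard

text \<open>The preimage of a null set is a box with one null factor, hence null even though the
  other factors have infinite measure. Projections thus stay measurable when source and target are
  both completed, which makes products of Lebesgue sets measurable.\<close>

lemma component_measurable_completion_PiM: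
  fixes I :: "nat set"
  assumes "finite I" "i \<in> I"
  shows "(\<lambda>x. x i) \<in> measurable (completion (Pi\<^sub>M I (\<lambda>_. lborel))) (lebesgue :: real measure)"
proof (rule completion.measurable_completion2)
  let ?P = "Pi\<^sub>M I (\<lambda>_. lborel :: real measure)"
  have m: "(\<lambda>x. x i) \<in> measurable ?P lborel"
    using assms by (intro measurable_component_singleton)
  then show m': "(\<lambda>x. x i) \<in> measurable (completion ?P) lborel"
    by (rule measurable_completion)
  show "null_sets lborel \<subseteq> null_sets (distr (completion ?P) lborel (\<lambda>x. x i))"
  proof
    fix N :: "real set" assume N: "N \<in> null_sets lborel"
    have "(\<lambda>x. x i) -` N \<inter> space ?P = Pi\<^sub>E I (\<lambda>j. if j = i then N else UNIV)"
      using assms by (auto simp: space_PiM PiE_iff split: if_splits)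
    also have "emeasure ?P \<dots> = (\<Prod>j\<in>I. emeasure lborel (if j = i then N else UNIV))"
      using assms N by (intro lborel_prod.emeasure_PiM) auto
    also have "\<dots> = 0"
      using assms N by (intro prod_zero) auto
    finally have "emeasure ?P ((\<lambda>x. x i) -` N \<inter> space ?P) = 0" .
    moreover have "(\<lambda>x. x i) -` N \<inter> space ?P \<in> sets ?P"
      using m N by (intro measurable_sets) auto
    ultimately show "N \<in> null_sets (distr (completion ?P) lborel (\<lambda>x. x i))"
      using N m' by (auto simp: null_sets_def emeasure_distr)
  qed
qed

lemma prod_set_measurable:
  assumes "\<And>i. i < d \<Longrightarrow> \<Omega> i \<in> sets lebesgue"
  shows "prod_set d \<Omega> \<in> sets (completion (Pi\<^sub>M {..<d} (\<lambda>_. lborel)))"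
proof -
  let ?P = "completion (Pi\<^sub>M {..<d} (\<lambda>_. lborel :: real measure))"
  have "prod_set d \<Omega> = {x \<in> space ?P. \<forall>i\<in>{..<d}. x i \<in> \<Omega> i}"
    by (auto simp: prod_set_def space_PiM PiE_def)
  also have "\<dots> \<in> sets ?P"
    using measurable_sets[OF component_measurable_completion_PiM assms]
    by (intro sets.sets_Collect_finite_All) (auto simp: vimage_def Int_def conj_commute)
  finally show ?thesis .
qed

lemma space_lebesgue_prod: "space (lebesgue_prod d \<Omega>) = prod_set d \<Omega>"
  by (auto simp: lebesgue_prod_def space_restrict_space space_PiM prod_set_def PiE_def)

lemma
  assumes "\<And>i. i < d \<Longrightarrow> \<Omega> i \<in> sets lebesgue"
  shows sets_lebesgue_prod_iff: "A \<in> sets (lebesgue_prod d \<Omega>) \<longleftrightarrow>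
      A \<subseteq> prod_set d \<Omega> \<and> A \<in> sets (completion (Pi\<^sub>M {..<d} (\<lambda>_. lborel)))"
    and emeasure_lebesgue_prod: "A \<subseteq> prod_set d \<Omega> \<Longrightarrow>
      emeasure (lebesgue_prod d \<Omega>) A = emeasure (completion (Pi\<^sub>M {..<d} (\<lambda>_. lborel))) A"
proof -
  have P: "prod_set d \<Omega> \<inter> space (completion (Pi\<^sub>M {..<d} (\<lambda>_. lborel)))
      \<in> sets (completion (Pi\<^sub>M {..<d} (\<lambda>_. lborel)))"
    using prod_set_measurable[OF assms] by (intro sets.Int sets.top)
  show "A \<in> sets (lebesgue_prod d \<Omega>) \<longleftrightarrow>
      A \<subseteq> prod_set d \<Omega> \<and> A \<in> sets (completion (Pi\<^sub>M {..<d} (\<lambda>_. lborel)))"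
    unfolding lebesgue_prod_def using sets_restrict_space_iff[OF P] by simp
  show "emeasure (lebesgue_prod d \<Omega>) A = emeasure (completion (Pi\<^sub>M {..<d} (\<lambda>_. lborel))) A"
    if "A \<subseteq> prod_set d \<Omega>"
    unfolding lebesgue_prod_def by (rule emeasure_restrict_space[OF P that])
qed

section \<open>Iterated integrals of Borel functions\<close>

text \<open>The additive counterpart of \<open>iter_qnorm\<close>, with the same order of variables
  and the same updates, so that the two recursions can be compared step by step. It integrates over
  the whole line, where Borel measurability is at hand.\<close>

primrec iter_integral :: "nat \<Rightarrow> ((nat \<Rightarrow> real) \<Rightarrow> ennreal) \<Rightarrow> (nat \<Rightarrow> real) \<Rightarrow> ennreal" where
  "iter_integral 0 g x = g x"
| "iter_integral (Suc k) g x = (\<integral>\<^sup>+ t. iter_integral k g (x(k := t)) \<partial>lborel)"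

lemma borel_measurable_add_dim:
  fixes g :: "(nat \<Rightarrow> real) \<Rightarrow> ennreal"
  assumes "g \<in> borel_measurable (Pi\<^sub>M {k..<d} (\<lambda>_. lborel))" "k < d"
  shows "(\<lambda>(x, t). g (x(k := t))) \<in> borel_measurable (Pi\<^sub>M {Suc k..<d} (\<lambda>_. lborel) \<Otimes>\<^sub>M lborel)"
proof -
  have "{k..<d} = insert k {Suc k..<d}" using assms by auto
  then show ?thesis
    using measurable_compose[OF measurable_add_dim[of k "{Suc k..<d}" "\<lambda>_. lborel"], of g borel] assms
    by (simp add: case_prod_beta')
qed

lemma borel_measurable_iter_integral:
  assumes "g \<in> borel_measurable (Pi\<^sub>M {..<d} (\<lambda>_. lborel))" "k \<le> d"
  shows "iter_integral k g \<in> borel_measurable (Pi\<^sub>M {k..<d} (\<lambda>_. lborel))"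
  using \<open>k \<le> d\<close>
proof (induction k)
  case 0
  then show ?case using assms(1) by (simp add: atLeast0LessThan cong: measurable_cong_simp)
next
  case (Suc k)
  then have "(\<lambda>(x, t). iter_integral k g (x(k := t)))
      \<in> borel_measurable (Pi\<^sub>M {Suc k..<d} (\<lambda>_. lborel) \<Otimes>\<^sub>M lborel)"
    by (intro borel_measurable_add_dim) auto
  then have "(\<lambda>x. \<integral>\<^sup>+ t. iter_integral k g (x(k := t)) \<partial>lborel)
      \<in> borel_measurable (Pi\<^sub>M {Suc k..<d} (\<lambda>_. lborel))"
    by (rule lborel.borel_measurable_nn_integral)
  then show ?case by (simp cong: measurable_cong_simp)
qed

lemma nn_integral_iter_integral:
  assumes "g \<in> borel_measurable (Pi\<^sub>M {..<d} (\<lambda>_. lborel))" "k \<le> d"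
  shows "(\<integral>\<^sup>+ x. iter_integral k g x \<partial>Pi\<^sub>M {k..<d} (\<lambda>_. lborel)) = (\<integral>\<^sup>+ x. g x \<partial>Pi\<^sub>M {..<d} (\<lambda>_. lborel))"
  using \<open>k \<le> d\<close>
proof (induction k)
  case 0
  then show ?case by (simp add: atLeast0LessThan)
next
  case (Suc k)
  have "{k..<d} = insert k {Suc k..<d}" using Suc.prems by auto
  then have "(\<integral>\<^sup>+ x. iter_integral k g x \<partial>Pi\<^sub>M {k..<d} (\<lambda>_. lborel)) =
      (\<integral>\<^sup>+ x. iter_integral (Suc k) g x \<partial>Pi\<^sub>M {Suc k..<d} (\<lambda>_. lborel))"
    using lborel_prod.product_nn_integral_insert[of "{Suc k..<d}" k "iter_integral k g"]
      borel_measurable_iter_integral[OF assms(1), of k] Suc.prems by simp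
  then show ?case using Suc by simp
qed

lemma iter_integral_full:
  assumes "g \<in> borel_measurable (Pi\<^sub>M {..<d} (\<lambda>_. lborel))"
  shows "iter_integral d g (\<lambda>_. undefined) = (\<integral>\<^sup>+ x. g x \<partial>Pi\<^sub>M {..<d} (\<lambda>_. lborel))"
  using nn_integral_iter_integral[OF assms, of d] lborel_prod.nn_integral_empty[of "iter_integral d g"]
  by simp

text \<open>Vanishing off the product survives integration, as far as the remaining coordinates are
  concerned. This allows an integral over the line to be read as one over \<open>\<Omega> k\<close>,
  the domain of the quasi-norm in that variable.\<close>

lemma iter_integral_nonzero_imp:
  assumes "\<And>x. g x \<noteq> 0 \<Longrightarrow> x \<in> Pi {..<d} \<Omega>" "iter_integral k g x \<noteq> 0" "k \<le> i" "i < d"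
  shows "x i \<in> \<Omega> i"
  using assms(2,3)
proof (induction k arbitrary: x)
  case 0
  then show ?case using assms(1,4) by auto
next
  case (Suc k)
  then have "\<exists>t. iter_integral k g (x(k := t)) \<noteq> 0"
    by (auto intro: ccontr)
  then obtain t where "iter_integral k g (x(k := t)) \<noteq> 0" ..
  from Suc.IH[OF this] Suc.prems show ?case by simp
qed

text \<open>Each variable multiplies the constant by (measure of \<open>\<Omega> k\<close> +
  1)^(1/r). The constant is quantified before \<open>g\<close>, \<open>h\<close> and
  \<open>x\<close> because the inductive bound is applied at all points \<open>x(k := t)\<close>
  under one integral. Extensionality makes \<open>x\<close> a point of the remaining product, so
  that the section in t is Borel measurable.\<close>

lemma iter_qnorm_lower_bound:
  assumes \<Omega>: "\<And>i. i < d \<Longrightarrow> \<Omega> i \<in> sets lebesgue" "\<And>i. i < d \<Longrightarrow> emeasure lebesgue (\<Omega> i) < \<infinity>"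
    and r: "0 < r" "\<And>i. i < d \<Longrightarrow> ennreal r \<le> p i"
    and k: "k \<le> d"
  shows "\<exists>C>0. \<forall>g h x. g \<in> borel_measurable (Pi\<^sub>M {..<d} (\<lambda>_. lborel)) \<longrightarrow>
    (\<forall>x. g x \<noteq> 0 \<longrightarrow> x \<in> Pi {..<d} \<Omega>) \<longrightarrow> (\<forall>x. epowr (g x) (1 / r) \<le> h x) \<longrightarrow>
    x \<in> extensional {k..<d} \<longrightarrow>
    epowr (iter_integral k g x) (1 / r) \<le> ennreal C * iter_qnorm \<Omega> p k h x"
  using k
proof (induction k)
  case 0
  show ?case by (intro exI[of _ 1]) auto
next
  case (Suc k)
  then obtain C where C: "C > 0" and IH:
    "g \<in> borel_measurable (Pi\<^sub>M {..<d} (\<lambda>_. lborel)) \<Longrightarrow>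
    (\<And>x. g x \<noteq> 0 \<Longrightarrow> x \<in> Pi {..<d} \<Omega>) \<Longrightarrow> (\<And>x. epowr (g x) (1 / r) \<le> h x) \<Longrightarrow>
    x \<in> extensional {k..<d} \<Longrightarrow>
    epowr (iter_integral k g x) (1 / r) \<le> ennreal C * iter_qnorm \<Omega> p k h x" for g h x
    by (auto simp: Suc_le_eq less_imp_le)
  let ?M = "lebesgue_on (\<Omega> k)"
  have k: "k < d" using Suc.prems by simp
  have fin: "emeasure ?M (space ?M) < top"
    using \<Omega>[OF k] by (simp add: emeasure_restrict_space)
  define K where "K = enn2real (epowr (emeasure ?M (space ?M) + 1) (1 / r))"
  have K: "ennreal K = epowr (emeasure ?M (space ?M) + 1) (1 / r)"
    unfolding K_def using fin by (intro ennreal_enn2real) (auto simp: less_top[symmetric])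
  then have "ennreal K \<noteq> 0" by simp
  then have K0: "K > 0" by (simp add: ennreal_eq_0_iff)
  show ?case
  proof (intro exI[of _ "C * K"] conjI allI impI)
    show "0 < C * K" using C K0 by simp
    fix g h :: "(nat \<Rightarrow> real) \<Rightarrow> ennreal" and x :: "nat \<Rightarrow> real"
    assume g: "g \<in> borel_measurable (Pi\<^sub>M {..<d} (\<lambda>_. lborel))"
      and supp: "\<forall>x. g x \<noteq> 0 \<longrightarrow> x \<in> Pi {..<d} \<Omega>"
      and le: "\<forall>x. epowr (g x) (1 / r) \<le> h x"
      and x: "x \<in> extensional {Suc k..<d}"
    have xs: "x \<in> space (Pi\<^sub>M {Suc k..<d} (\<lambda>_. lborel))"
      using x by (simp add: space_PiM PiE_def)
    have "(\<lambda>(x, t). iter_integral k g (x(k := t)))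
        \<in> borel_measurable (Pi\<^sub>M {Suc k..<d} (\<lambda>_. lborel) \<Otimes>\<^sub>M lborel)"
      using k g by (intro borel_measurable_add_dim borel_measurable_iter_integral) auto
    from measurable_compose[OF measurable_Pair1'[OF xs] this]
    have m: "(\<lambda>t. iter_integral k g (x(k := t))) \<in> borel_measurable lborel" by simp
    have m': "(\<lambda>t. iter_integral k g (x(k := t))) \<in> borel_measurable ?M"
      by (intro measurable_restrict_space1 measurable_completion m)
    have zero: "iter_integral k g (x(k := t)) = 0" if "t \<notin> \<Omega> k" for t
      using iter_integral_nonzero_imp[of g d \<Omega> k "x(k := t)" k] supp that k by auto
    have eq: "iter_integral (Suc k) g x = (\<integral>\<^sup>+ t. iter_integral k g (x(k := t)) \<partial>?M)"
    proof -
      have "(\<integral>\<^sup>+ t. iter_integral k g (x(k := t)) \<partial>?M) =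
          (\<integral>\<^sup>+ t. iter_integral k g (x(k := t)) * indicator (\<Omega> k) t \<partial>lebesgue)"
        using \<Omega>[OF k] by (intro nn_integral_restrict_space) auto
      also have "\<dots> = (\<integral>\<^sup>+ t. iter_integral k g (x(k := t)) \<partial>lebesgue)"
        by (intro nn_integral_cong) (auto simp: zero split: split_indicator)
      finally show ?thesis by (simp add: nn_integral_completion)
    qed
    have "epowr (\<integral>\<^sup>+ t. iter_integral k g (x(k := t)) \<partial>?M) (1 / r) \<le>
        ennreal C * epowr (emeasure ?M (space ?M) + 1) (1 / r) *
        Lp_qnorm ?M (p k) (\<lambda>t. iter_qnorm \<Omega> p k h (x(k := t)))"
    proof (intro Lp_qnorm_lower_bound m' r C k IH g)
      show "x(k := t) \<in> extensional {k..<d}" for t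
        using x k by (auto simp: extensional_def)
    qed (use supp le in auto)
    then show "epowr (iter_integral (Suc k) g x) (1 / r) \<le>
        ennreal (C * K) * iter_qnorm \<Omega> p (Suc k) h x"
      unfolding eq using C K0 by (simp add: K ennreal_mult)
  qed
qed

lemma mixed_qnorm_indicator_lower_bound:
  assumes \<Omega>: "\<And>i. i < d \<Longrightarrow> \<Omega> i \<in> sets lebesgue" "\<And>i. i < d \<Longrightarrow> emeasure lebesgue (\<Omega> i) < \<infinity>"
    and r: "0 < r" "\<And>i. i < d \<Longrightarrow> ennreal r \<le> p i"
  obtains C where "C > 0" "\<And>A. A \<in> sets (lebesgue_prod d \<Omega>) \<Longrightarrow>
    epowr (emeasure (lebesgue_prod d \<Omega>) A) (1 / r) \<le> ennreal C * mixed_qnorm d \<Omega> p (indicator A)"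
proof -
  obtain C where C: "C > 0" and le:
    "g \<in> borel_measurable (Pi\<^sub>M {..<d} (\<lambda>_. lborel)) \<Longrightarrow>
    (\<And>x. g x \<noteq> 0 \<Longrightarrow> x \<in> Pi {..<d} \<Omega>) \<Longrightarrow> (\<And>x. epowr (g x) (1 / r) \<le> h x) \<Longrightarrow>
    x \<in> extensional {d..<d} \<Longrightarrow>
    epowr (iter_integral d g x) (1 / r) \<le> ennreal C * iter_qnorm \<Omega> p d h x" for g h x
    using iter_qnorm_lower_bound[of d \<Omega> r p d] assms by auto
  show ?thesis
  proof (rule that[OF C])
    fix A assume A: "A \<in> sets (lebesgue_prod d \<Omega>)"
    let ?P = "Pi\<^sub>M {..<d} (\<lambda>_. lborel :: real measure)"
    have A': "A \<subseteq> prod_set d \<Omega>" "A \<in> sets (completion ?P)"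
      using A sets_lebesgue_prod_iff[of d \<Omega> A] \<Omega>(1) by simp_all
    \<comment> \<open>The Borel main part has the measure of \<open>A\<close>, while the quasi-norm
      on the right keeps \<open>A\<close> itself; the two are linked by the pointwise comparison of
      their indicators.\<close>
    define B where "B = main_part ?P A"
    have B: "B \<in> sets ?P" "B \<subseteq> A"
      using A' main_part_null_part_Un[of A ?P] unfolding B_def by (simp, blast)
    have "epowr (iter_integral d (indicator B) (\<lambda>_. undefined)) (1 / r) \<le>
        ennreal C * iter_qnorm \<Omega> p d (\<lambda>x. ennreal \<bar>indicator A x\<bar>) (\<lambda>_. undefined)"
      using B A' by (intro le) (auto simp: prod_set_def PiE_def split: split_indicator split_indicator_asm)
    moreover have "iter_integral d (indicator B) (\<lambda>_. undefined) = emeasure (lebesgue_prod d \<Omega>) A"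
    proof -
      have "iter_integral d (indicator B) (\<lambda>_. undefined) = emeasure ?P B"
        using B by (subst iter_integral_full) auto
      also have "\<dots> = emeasure (lebesgue_prod d \<Omega>) A"
        using A' \<Omega>(1) unfolding B_def by (simp add: emeasure_lebesgue_prod)
      finally show ?thesis .
    qed
    ultimately show "epowr (emeasure (lebesgue_prod d \<Omega>) A) (1 / r) \<le>
        ennreal C * mixed_qnorm d \<Omega> p (indicator A)"
      by (simp add: mixed_qnorm_def)
  qed
qed

section \<open>The Lorentz functional and rearrangements\<close>

text \<open>The Lorentz quasi-norm with the size of the superlevel set at height u as a free
  argument. Mixed quasi-norms of superlevel sets and powers of their measures are then two arguments
  of the same functional.\<close>

definition lorentz_functional :: "ennreal \<Rightarrow> (real \<Rightarrow> ennreal) \<Rightarrow> ennreal" where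
  "lorentz_functional q N =
     (if q = \<infinity> then (SUP u\<in>{0<..}. ennreal u * N u)
      else epowr (\<integral>\<^sup>+ u\<in>{0<..}. ennreal (u powr enn2real q) * epowr (N u) (enn2real q)
                      * ennreal (1 / u) \<partial>lborel) (1 / enn2real q))"

lemma lorentz_qnorm_eq_functional:
  "lorentz_qnorm d \<Omega> p q f =
    lorentz_functional q (\<lambda>u. mixed_qnorm d \<Omega> p (indicator {x \<in> prod_set d \<Omega>. \<bar>f x\<bar> > u}))"
  by (simp add: lorentz_qnorm_def lorentz_functional_def Let_def)

lemma lorentz_functional_mono:
  assumes "\<And>u. 0 < u \<Longrightarrow> E u \<le> N u"
  shows "lorentz_functional q E \<le> lorentz_functional q N"
proof -
  have "ennreal u * E u \<le> ennreal u * N u" if "0 < u" for u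
    using assms[OF that] by (intro mult_left_mono) auto
  moreover have "ennreal (u powr a) * epowr (E u) a * ennreal (1 / u) * indicator {0<..} u \<le>
      ennreal (u powr a) * epowr (N u) a * ennreal (1 / u) * indicator {0<..} u" if "0 \<le> a" for u a
    using assms[of u] that by (auto intro!: mult_left_mono mult_right_mono epowr_mono split: split_indicator)
  ultimately show ?thesis
    unfolding lorentz_functional_def
    by (auto intro!: SUP_mono epowr_mono nn_integral_mono)
qed

lemma lorentz_functional_cmult:
  assumes [measurable]: "E \<in> borel_measurable borel" and q: "0 < q" and C: "0 \<le> C"
  shows "lorentz_functional q (\<lambda>u. ennreal C * E u) = ennreal C * lorentz_functional q E"
proof (cases "q = \<infinity>")
  case True
  have "(SUP u\<in>{0<..}. ennreal u * (ennreal C * E u)) = (SUP u\<in>{0<..}. ennreal C * (ennreal u * E u))"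
    by (simp add: mult_ac)
  then show ?thesis using True by (simp add: lorentz_functional_def SUP_mult_left_ennreal)
next
  case False
  define Q where "Q = enn2real q"
  have Q: "0 < Q" using False q by (simp add: Q_def enn2real_positive_iff less_top[symmetric])
  have "(\<integral>\<^sup>+ u\<in>{0<..}. ennreal (u powr Q) * epowr (ennreal C * E u) Q * ennreal (1 / u) \<partial>lborel) =
    (\<integral>\<^sup>+ u. epowr (ennreal C) Q * (ennreal (u powr Q) * epowr (E u) Q * ennreal (1 / u) * indicator {0<..} u) \<partial>lborel)"
    using Q by (intro nn_integral_cong) (simp add: epowr_mult mult_ac)
  also have "\<dots> = epowr (ennreal C) Q *
      (\<integral>\<^sup>+ u\<in>{0<..}. ennreal (u powr Q) * epowr (E u) Q * ennreal (1 / u) \<partial>lborel)"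
    by (intro nn_integral_cmult) measurable
  finally show ?thesis
    using False Q by (simp add: lorentz_functional_def Q_def[symmetric] epowr_mult)
qed

text \<open>By monotonicity E u >= E s on (0, s), and integrating u^(Q-1) over that interval alone
  gives s^Q / Q. This explains the constant Q^(1/Q).\<close>

lemma lorentz_functional_ge_weak:
  assumes q: "0 < q"
  obtains B where "B > 0" "\<And>E s. antimono E \<Longrightarrow> 0 < s \<Longrightarrow>
    ennreal s * E s \<le> ennreal B * lorentz_functional q E"
proof (cases "q = \<infinity>")
  case True
  show ?thesis
    by (rule that[of 1]) (use True in \<open>auto simp: lorentz_functional_def intro: SUP_upper\<close>)
next
  case False
  define Q where "Q = enn2real q"
  have Q: "0 < Q" using False q by (simp add: Q_def enn2real_positive_iff less_top[symmetric])
  show ?thesis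
  proof (rule that[of "Q powr (1 / Q)"])
    show "Q powr (1 / Q) > 0" using Q by simp
    fix E :: "real \<Rightarrow> ennreal" and s :: real assume E: "antimono E" and s: "0 < s"
    let ?I = "\<integral>\<^sup>+ u\<in>{0<..}. ennreal (u powr Q) * epowr (E u) Q * ennreal (1 / u) \<partial>lborel"
    have "ennreal (s powr Q / Q) * epowr (E s) Q =
        (\<integral>\<^sup>+ u\<in>{0<..<s}. ennreal (u powr (Q - 1)) \<partial>lborel) * epowr (E s) Q"
      using Q s by (simp add: nn_integral_powr_from_0)
    also have "\<dots> = (\<integral>\<^sup>+ u. ennreal (u powr (Q - 1)) * indicator {0<..<s} u * epowr (E s) Q \<partial>lborel)"
      by (intro nn_integral_multc[symmetric]) measurable
    also have "\<dots> \<le> ?I"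
    proof (intro nn_integral_mono)
      fix u :: real
      show "ennreal (u powr (Q - 1)) * indicator {0<..<s} u * epowr (E s) Q
        \<le> ennreal (u powr Q) * epowr (E u) Q * ennreal (1 / u) * indicator {0<..} u"
      proof (cases "0 < u \<and> u < s")
        case True
        then have "epowr (E s) Q \<le> epowr (E u) Q" using Q antimonoD[OF E, of u s] by (intro epowr_mono) auto
        then have "ennreal (u powr (Q - 1)) * epowr (E s) Q \<le> ennreal (u powr Q * (1 / u)) * epowr (E u) Q"
          using True by (simp add: powr_diff mult_left_mono)
        moreover have "ennreal (u powr Q * (1 / u)) = ennreal (u powr Q) * ennreal (1 / u)"
          using True by (intro ennreal_mult) auto
        ultimately show ?thesis using True by (simp only: mult_ac) simp
      qed (auto split: split_indicator)
    qed
    finally have "ennreal Q * (ennreal (s powr Q / Q) * epowr (E s) Q) \<le> ennreal Q * ?I"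
      by (intro mult_left_mono) auto
    moreover have "ennreal Q * (ennreal (s powr Q / Q) * epowr (E s) Q) = epowr (ennreal s * E s) Q"
      using Q s by (simp add: epowr_mult epowr_ennreal flip: mult.assoc ennreal_mult)
    ultimately have "ennreal s * E s \<le> epowr (ennreal Q * ?I) (1 / Q)"
      using Q epowr_mono[of "epowr (ennreal s * E s) Q" "ennreal Q * ?I" "1 / Q"] by simp
    then show "ennreal s * E s \<le> ennreal (Q powr (1 / Q)) * lorentz_functional q E"
      using Q False by (simp add: lorentz_functional_def Q_def[symmetric] epowr_mult epowr_ennreal)
  qed
qed

text \<open>For \<open>q < v\<close>, split \<open>(u E u)\<^sup>v = (u E u)\<^sup>v\<^sup>-\<^sup>q (u E u)\<^sup>q\<close> and bound the first factor by the weak norm.\<close>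

lemma lorentz_functional_embedding:
  assumes q: "0 < q" "q \<le> v"
  obtains B where "B > 0" "\<And>E. antimono E \<Longrightarrow> E \<in> borel_measurable borel \<Longrightarrow>
    lorentz_functional v E \<le> ennreal B * lorentz_functional q E"
proof -
  obtain B where B: "B > 0" "\<And>E s. antimono E \<Longrightarrow> 0 < s \<Longrightarrow>
      ennreal s * E s \<le> ennreal B * lorentz_functional q E"
    using lorentz_functional_ge_weak[OF q(1)] by blast
  consider "q = v" | "v = \<infinity>" | "q < v" "v < \<infinity>" using q by (cases "q = v"; cases "v = \<infinity>") (auto simp: less_top)
  then show ?thesis
  proof cases
    case 1
    then show ?thesis by (intro that[of 1]) auto
  next
    case 2
    then show ?thesis
      using B by (intro that[of B]) (auto simp: lorentz_functional_def intro!: SUP_least)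
  next
    case 3
    obtain Q where Q: "q = ennreal Q" "0 < Q" using q 3 by (cases q) auto
    obtain V where V: "v = ennreal V" "Q < V" using 3 Q by (cases v) (auto simp: ennreal_less_iff)
    show ?thesis
    proof (rule that)
      show "(B powr (V - Q)) powr (1 / V) > 0" using B(1) by simp
      fix E :: "real \<Rightarrow> ennreal" assume E: "antimono E" and [measurable]: "E \<in> borel_measurable borel"
      let ?L = "lorentz_functional q E"
      have "(\<integral>\<^sup>+ u\<in>{0<..}. ennreal (u powr V) * epowr (E u) V * ennreal (1 / u) \<partial>lborel) \<le>
        (\<integral>\<^sup>+ u. epowr (ennreal B * ?L) (V - Q) *
          (ennreal (u powr Q) * epowr (E u) Q * ennreal (1 / u) * indicator {0<..} u) \<partial>lborel)"
      proof (intro nn_integral_mono)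
        fix u :: real
        show "ennreal (u powr V) * epowr (E u) V * ennreal (1 / u) * indicator {0<..} u \<le>
          epowr (ennreal B * ?L) (V - Q) *
          (ennreal (u powr Q) * epowr (E u) Q * ennreal (1 / u) * indicator {0<..} u)"
        proof (cases "0 < u")
          case True
          have "ennreal (u powr V) * epowr (E u) V = epowr (ennreal u * E u) ((V - Q) + Q)"
            using True V Q by (simp add: epowr_mult epowr_ennreal)
          also have "\<dots> = epowr (ennreal u * E u) (V - Q) * epowr (ennreal u * E u) Q"
            using V Q by (intro epowr_add) auto
          also have "\<dots> \<le> epowr (ennreal B * ?L) (V - Q) * epowr (ennreal u * E u) Q"
            using B(2)[OF E True] V by (intro mult_right_mono epowr_mono) auto
          also have "epowr (ennreal u * E u) Q = ennreal (u powr Q) * epowr (E u) Q"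
            using True Q by (simp add: epowr_mult epowr_ennreal)
          finally have "ennreal (u powr V) * epowr (E u) V * ennreal (1 / u) \<le>
              epowr (ennreal B * ?L) (V - Q) * (ennreal (u powr Q) * epowr (E u) Q) * ennreal (1 / u)"
            by (intro mult_right_mono) auto
          then show ?thesis using True by (simp add: mult_ac)
        qed auto
      qed
      also have "\<dots> = epowr (ennreal B * ?L) (V - Q) *
          (\<integral>\<^sup>+ u\<in>{0<..}. ennreal (u powr Q) * epowr (E u) Q * ennreal (1 / u) \<partial>lborel)"
        by (intro nn_integral_cmult) measurable
      also have "(\<integral>\<^sup>+ u\<in>{0<..}. ennreal (u powr Q) * epowr (E u) Q * ennreal (1 / u) \<partial>lborel) =
          epowr ?L Q"
        using Q by (simp add: lorentz_functional_def)
      \<comment> \<open>Adding the exponents is legitimate for an infinite \<open>?L\<close> as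
        well, because both are positive.\<close>
      also have "epowr (ennreal B * ?L) (V - Q) * epowr ?L Q = ennreal (B powr (V - Q)) * epowr ?L V"
        using V Q B epowr_add[of "V - Q" Q ?L] by (simp add: epowr_mult epowr_ennreal mult.assoc)
      finally have "epowr (\<integral>\<^sup>+ u\<in>{0<..}. ennreal (u powr V) * epowr (E u) V * ennreal (1 / u) \<partial>lborel) (1 / V)
          \<le> epowr (ennreal (B powr (V - Q)) * epowr ?L V) (1 / V)"
        using V Q by (intro epowr_mono) auto
      also have "\<dots> = ennreal ((B powr (V - Q)) powr (1 / V)) * ?L"
        using V Q by (simp add: epowr_mult epowr_ennreal)
      finally show "lorentz_functional v E \<le> ennreal ((B powr (V - Q)) powr (1 / V)) * ?L"
        using V Q by (simp add: lorentz_functional_def)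
    qed
  qed
qed

section \<open>Distribution functions and rearrangements\<close>

lemma less_rearrangement_imp:
  assumes "0 < s" "ennreal s < rearrangement M f t"
  shows "ennreal t < emeasure M {x \<in> space M. \<bar>f x\<bar> > s}"
proof (rule ccontr)
  assume "\<not> ennreal t < emeasure M {x \<in> space M. \<bar>f x\<bar> > s}"
  then have "rearrangement M f t \<le> ennreal s"
    unfolding rearrangement_def using assms(1) by (intro Inf_lower) (auto simp: not_less)
  with assms(2) show False by simp
qed

lemma rearrangement_ge:
  assumes "f \<in> borel_measurable M" "ennreal t < emeasure M {x \<in> space M. \<bar>f x\<bar> > s}"
  shows "ennreal s \<le> rearrangement M f t"
  unfolding rearrangement_def
proof (rule Inf_greatest, safe)
  fix s' assume s': "emeasure M {x \<in> space M. \<bar>f x\<bar> > s'} \<le> ennreal t" "s' > 0"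
  show "ennreal s \<le> ennreal s'"
  proof (rule ccontr)
    assume "\<not> ennreal s \<le> ennreal s'"
    then have "s' < s" using s' by (simp add: not_le ennreal_less_iff less_imp_le)
    then have "emeasure M {x \<in> space M. \<bar>f x\<bar> > s} \<le> emeasure M {x \<in> space M. \<bar>f x\<bar> > s'}"
      using assms(1) by (intro emeasure_mono) (auto, measurable)
    then show False using s' assms(2) by auto
  qed
qed

text \<open>Any s below f*(t) has a superlevel set of measure above t, so s t^a <= W; letting s
  increase to f*(t) gives the bound.\<close>

lemma rearrangement_bound_by_weak:
  assumes W: "\<And>s. 0 < s \<Longrightarrow> ennreal s * epowr (emeasure M {x \<in> space M. \<bar>f x\<bar> > s}) a \<le> W"
    and t: "0 < t" and a: "0 < a"
  shows "ennreal (t powr a) * rearrangement M f t \<le> W"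
proof -
  have "rearrangement M f t \<le> ennreal (1 / t powr a) * W"
  proof (rule dense_le)
    fix y assume y: "y < rearrangement M f t"
    then obtain s where s: "y = ennreal s" "0 \<le> s" by (cases y) auto
    show "y \<le> ennreal (1 / t powr a) * W"
    proof (cases "s = 0")
      case False
      then have "ennreal t \<le> emeasure M {x \<in> space M. \<bar>f x\<bar> > s}"
        using less_rearrangement_imp[of s M f t] s y by simp
      then have "epowr (ennreal t) a \<le> epowr (emeasure M {x \<in> space M. \<bar>f x\<bar> > s}) a"
        using a by (intro epowr_mono) auto
      then have "ennreal s * epowr (ennreal t) a \<le>
          ennreal s * epowr (emeasure M {x \<in> space M. \<bar>f x\<bar> > s}) a"
        by (intro mult_left_mono) auto
      also have "\<dots> \<le> W" using False s by (intro W) auto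
      finally have "ennreal s * epowr (ennreal t) a \<le> W" .
      then have "ennreal (1 / t powr a) * (ennreal s * epowr (ennreal t) a) \<le> ennreal (1 / t powr a) * W"
        by (intro mult_left_mono) auto
      moreover have "ennreal (1 / t powr a) * (ennreal s * epowr (ennreal t) a) = y"
        using s t by (simp add: epowr_ennreal flip: ennreal_mult)
      ultimately show ?thesis by simp
    qed (use s in auto)
  qed
  then have "ennreal (t powr a) * rearrangement M f t \<le> ennreal (t powr a) * (ennreal (1 / t powr a) * W)"
    by (intro mult_left_mono) auto
  then show ?thesis using t by (simp flip: ennreal_mult mult.assoc)
qed


lemma
  assumes f [measurable]: "f \<in> borel_measurable M"
  shows antimono_distribution: "antimono (\<lambda>u::real. emeasure M {x \<in> space M. \<bar>f x\<bar> > u})"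
    and borel_measurable_distribution:
      "(\<lambda>u::real. emeasure M {x \<in> space M. \<bar>f x\<bar> > u}) \<in> borel_measurable borel"
proof -
  let ?D = "\<lambda>u::real. emeasure M {x \<in> space M. \<bar>f x\<bar> > u}"
  have anti: "?D v \<le> ?D u" if "u \<le> v" for u v
  proof (rule emeasure_mono)
    show "{x \<in> space M. \<bar>f x\<bar> > u} \<in> sets M" by measurable
  qed (use that in auto)
  then show "antimono ?D" by (rule antimonoI)
  show "?D \<in> borel_measurable borel"
  proof (rule borel_measurableI_greater)
    fix y
    \<comment> \<open>Superlevel sets of a monotone function are intervals, hence Borel.\<close>
    have "is_interval {u. y < ?D u}"
      using anti by (auto simp: is_interval_1 intro: less_le_trans)
    then show "{u \<in> space borel. y < ?D u} \<in> sets borel"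
      by (simp add: real_interval_borel_measurable)
  qed
qed

text \<open>For s below f*(t) the interval (0, s) lies in the set of heights whose superlevel set
  has measure above t, and V u^(V-1) integrates to s^V over it. This half of the layer-cake formula
  is what an upper estimate calls for.\<close>

lemma rearrangement_layer_cake_le:
  assumes f: "f \<in> borel_measurable M" and V: "0 < V"
  shows "epowr (rearrangement M f t) V \<le>
    (\<integral>\<^sup>+ u. ennreal (V * u powr (V - 1)) *
      indicator {u. 0 < u \<and> ennreal t < emeasure M {x \<in> space M. \<bar>f x\<bar> > u}} u \<partial>lborel)"
    (is "_ \<le> ?G")
proof -
  have "rearrangement M f t \<le> epowr ?G (1 / V)"
  proof (rule dense_le)
    fix y assume y: "y < rearrangement M f t"
    then obtain s where s: "y = ennreal s" "0 \<le> s" by (cases y) auto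
    show "y \<le> epowr ?G (1 / V)"
    proof (cases "s = 0")
      case False
      then have D: "ennreal t < emeasure M {x \<in> space M. \<bar>f x\<bar> > s}"
        using less_rearrangement_imp[of s M f t] s y by simp
      have "ennreal (s powr V) = ennreal V * (\<integral>\<^sup>+ u\<in>{0<..<s}. ennreal (u powr (V - 1)) \<partial>lborel)"
        using V s by (simp add: nn_integral_powr_from_0 flip: ennreal_mult)
      also have "\<dots> = (\<integral>\<^sup>+ u. ennreal V * (ennreal (u powr (V - 1)) * indicator {0<..<s} u) \<partial>lborel)"
        by (intro nn_integral_cmult[symmetric]) measurable
      also have "\<dots> \<le> ?G"
        using V D antimono_distribution[OF f, THEN antimonoD, of _ s]
        by (intro nn_integral_mono) (auto simp: ennreal_mult intro: less_le_trans split: split_indicator)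
      finally have "epowr (ennreal (s powr V)) (1 / V) \<le> epowr ?G (1 / V)"
        using V by (intro epowr_mono) auto
      then show ?thesis using s V by (simp add: epowr_ennreal powr_powr)
    qed (use s in auto)
  qed
  then have "epowr (rearrangement M f t) V \<le> epowr (epowr ?G (1 / V)) V"
    using V by (intro epowr_mono) auto
  then show ?thesis using V by simp
qed

text \<open>After the layer-cake bound is inserted, Tonelli turns the condition t < D u into the
  range of an inner integral of t^(V/r - 1), which equals (r/V) D(u)^(V/r). The factor V of the
  layer cake cancels and \<open>r\<close> remains, whence the constant r^(1/V).\<close>

lemma weighted_rearr_le_functional:
  assumes f [measurable]: "f \<in> borel_measurable M" and fin: "emeasure M (space M) < \<infinity>"
    and r: "0 < r" and V: "0 < V" and K: "0 \<le> K" "\<And>t. 0 < t \<Longrightarrow> t < \<epsilon> \<Longrightarrow> \<kappa> t \<le> K"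
  shows "weighted_rearr M (ennreal r) \<epsilon> \<kappa> (ennreal V) f \<le> ennreal (K * r powr (1 / V)) *
    lorentz_functional (ennreal V) (\<lambda>u. epowr (emeasure M {x \<in> space M. \<bar>f x\<bar> > u}) (1 / r))"
proof -
  define D where "D = (\<lambda>u::real. emeasure M {x \<in> space M. \<bar>f x\<bar> > u})"
  have D [measurable]: "D \<in> borel_measurable borel"
    unfolding D_def by (rule borel_measurable_distribution[OF f])
  \<comment> \<open>The range of t is enlarged from (0, \<epsilon>) to the whole half-line, so that
    the inner integral in t has a closed form.\<close>
  define F :: "real \<Rightarrow> real \<Rightarrow> ennreal" where
    "F = (\<lambda>t u. ennreal (t powr (V / r - 1)) * indicator {0<..} t *
      (ennreal (V * u powr (V - 1)) * indicator {u. 0 < u \<and> ennreal t < D u} u))"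
  have F [measurable]: "case_prod F \<in> borel_measurable (lborel \<Otimes>\<^sub>M lborel)"
    unfolding F_def by measurable
  have pointwise: "epowr (ennreal (\<kappa> t * t powr (1 / r)) * rearrangement M f t) V * ennreal (1 / t) *
      indicator {0<..<\<epsilon>} t \<le> ennreal (K powr V) * (\<integral>\<^sup>+ u. F t u \<partial>lborel)" for t
  proof (cases "0 < t \<and> t < \<epsilon>")
    case True
    have "epowr (ennreal (\<kappa> t * t powr (1 / r)) * rearrangement M f t) V \<le>
        epowr (ennreal (K * t powr (1 / r)) * rearrangement M f t) V"
      using V True K by (intro epowr_mono mult_right_mono ennreal_leI) auto
    also have "\<dots> = ennreal (K powr V * t powr (V / r)) * epowr (rearrangement M f t) V"
      using V K by (simp add: epowr_mult epowr_ennreal powr_mult powr_powr)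
    also have "\<dots> \<le> ennreal (K powr V * t powr (V / r)) *
      (\<integral>\<^sup>+ u. ennreal (V * u powr (V - 1)) * indicator {u. 0 < u \<and> ennreal t < D u} u \<partial>lborel)"
      unfolding D_def by (intro mult_left_mono rearrangement_layer_cake_le f V) auto
    finally have "epowr (ennreal (\<kappa> t * t powr (1 / r)) * rearrangement M f t) V * ennreal (1 / t) \<le>
      ennreal (K powr V * t powr (V / r)) *
      (\<integral>\<^sup>+ u. ennreal (V * u powr (V - 1)) * indicator {u. 0 < u \<and> ennreal t < D u} u \<partial>lborel) *
      ennreal (1 / t)"
      by (intro mult_right_mono) auto
    also have "\<dots> = ennreal (K powr V * (t powr (V / r) * (1 / t))) *
      (\<integral>\<^sup>+ u. ennreal (V * u powr (V - 1)) * indicator {u. 0 < u \<and> ennreal t < D u} u \<partial>lborel)"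
      using True by (subst mult.assoc, subst mult.commute[of _ "ennreal (1 / t)"])
        (simp flip: ennreal_mult mult.assoc)
    also have "t powr (V / r) * (1 / t) = t powr (V / r - 1)"
      using True by (simp add: powr_diff)
    also have "ennreal (K powr V * t powr (V / r - 1)) *
      (\<integral>\<^sup>+ u. ennreal (V * u powr (V - 1)) * indicator {u. 0 < u \<and> ennreal t < D u} u \<partial>lborel) =
      ennreal (K powr V) * (\<integral>\<^sup>+ u. F t u \<partial>lborel)"
      using True by (simp add: F_def nn_integral_cmult ennreal_mult mult.assoc)
    finally show ?thesis using True by simp
  qed auto
  have inner: "(\<integral>\<^sup>+ t. F t u \<partial>lborel) = ennreal r *
      (ennreal (u powr V) * epowr (epowr (D u) (1 / r)) V * ennreal (1 / u) * indicator {0<..} u)" for u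
  proof (cases "0 < u")
    case True
    \<comment> \<open>Finite total measure makes \<open>D u\<close> a real number, so the inner
      integral runs over a bounded interval.\<close>
    have "D u \<le> emeasure M (space M)" unfolding D_def by (rule emeasure_space)
    then obtain \<delta> where \<delta>: "D u = ennreal \<delta>" "0 \<le> \<delta>" using fin by (cases "D u") (auto simp: top_unique)
    have "(\<integral>\<^sup>+ t. F t u \<partial>lborel) =
      (\<integral>\<^sup>+ t. ennreal (V * u powr (V - 1)) * (ennreal (t powr (V / r - 1)) * indicator {0<..<\<delta>} t) \<partial>lborel)"
      using True \<delta> by (intro nn_integral_cong) (auto simp: F_def ennreal_less_iff mult_ac split: split_indicator)
    also have "\<dots> = ennreal (V * u powr (V - 1)) * (\<integral>\<^sup>+ t\<in>{0<..<\<delta>}. ennreal (t powr (V / r - 1)) \<partial>lborel)"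
      by (intro nn_integral_cmult) measurable
    also have "\<dots> = ennreal (V * u powr (V - 1) * (\<delta> powr (V / r) / (V / r)))"
      using V r \<delta> by (simp add: nn_integral_powr_from_0 flip: ennreal_mult)
    also have "V * u powr (V - 1) * (\<delta> powr (V / r) / (V / r)) =
        r * (u powr V * \<delta> powr (V / r) * (1 / u))"
      using V r True by (simp add: powr_diff field_simps)
    finally show ?thesis
      using True V r \<delta> by (simp add: epowr_epowr epowr_ennreal powr_powr mult.assoc flip: ennreal_mult)
  qed (simp add: F_def)
  have "(\<integral>\<^sup>+ t\<in>{0<..<\<epsilon>}. epowr (ennreal (\<kappa> t * t powr (1 / r)) * rearrangement M f t) V *
      ennreal (1 / t) \<partial>lborel) \<le> (\<integral>\<^sup>+ t. ennreal (K powr V) * (\<integral>\<^sup>+ u. F t u \<partial>lborel) \<partial>lborel)"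
    by (intro nn_integral_mono pointwise)
  also have "\<dots> = ennreal (K powr V) * (\<integral>\<^sup>+ t. (\<integral>\<^sup>+ u. F t u \<partial>lborel) \<partial>lborel)"
    by (intro nn_integral_cmult) measurable
  also have "(\<integral>\<^sup>+ t. (\<integral>\<^sup>+ u. F t u \<partial>lborel) \<partial>lborel) = (\<integral>\<^sup>+ u. (\<integral>\<^sup>+ t. F t u \<partial>lborel) \<partial>lborel)"
    by (rule lborel_pair.Fubini'[symmetric, OF F])
  also have "\<dots> = ennreal r * (\<integral>\<^sup>+ u\<in>{0<..}. ennreal (u powr V) *
      epowr (epowr (D u) (1 / r)) V * ennreal (1 / u) \<partial>lborel)"
    unfolding inner by (intro nn_integral_cmult) measurable
  finally have "epowr (\<integral>\<^sup>+ t\<in>{0<..<\<epsilon>}. epowr (ennreal (\<kappa> t * t powr (1 / r)) * rearrangement M f t) V *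
      ennreal (1 / t) \<partial>lborel) (1 / V) \<le> epowr (ennreal (K powr V) * (ennreal r *
      (\<integral>\<^sup>+ u\<in>{0<..}. ennreal (u powr V) *
      epowr (epowr (D u) (1 / r)) V * ennreal (1 / u) \<partial>lborel))) (1 / V)"
    using V by (intro epowr_mono) auto
  also have "\<dots> = ennreal (K * r powr (1 / V)) * lorentz_functional (ennreal V) (\<lambda>u. epowr (D u) (1 / r))"
    using V K r by (simp add: lorentz_functional_def epowr_mult epowr_ennreal powr_powr ennreal_mult mult.assoc)
  finally show ?thesis
    using V r by (simp add: weighted_rearr_def Let_def D_def)
qed


lemma weighted_rearr_infinity_le_functional:
  assumes r: "0 < r" and K: "0 \<le> K" "\<And>t. 0 < t \<Longrightarrow> t < \<epsilon> \<Longrightarrow> \<kappa> t \<le> K"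
  shows "weighted_rearr M (ennreal r) \<epsilon> \<kappa> \<infinity> f \<le> ennreal K *
    lorentz_functional \<infinity> (\<lambda>u. epowr (emeasure M {x \<in> space M. \<bar>f x\<bar> > u}) (1 / r))"
    (is "_ \<le> _ * ?L")
proof -
  have "ennreal (\<kappa> t * t powr (1 / r)) * rearrangement M f t \<le> ennreal K * ?L" if t: "0 < t" "t < \<epsilon>" for t
  proof -
    have "ennreal s * epowr (emeasure M {x \<in> space M. \<bar>f x\<bar> > s}) (1 / r) \<le> ?L" if "0 < s" for s
      using that unfolding lorentz_functional_def by (auto intro: SUP_upper)
    then have "ennreal (t powr (1 / r)) * rearrangement M f t \<le> ?L"
      using t r by (intro rearrangement_bound_by_weak) auto
    then have "ennreal K * (ennreal (t powr (1 / r)) * rearrangement M f t) \<le> ennreal K * ?L"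
      by (intro mult_left_mono) auto
    moreover have "ennreal (\<kappa> t * t powr (1 / r)) * rearrangement M f t \<le>
        ennreal (K * t powr (1 / r)) * rearrangement M f t"
      using t K by (intro mult_right_mono ennreal_leI) auto
    ultimately show ?thesis using K by (simp add: ennreal_mult mult.assoc)
  qed
  then show ?thesis using r by (auto simp: weighted_rearr_def Let_def intro!: SUP_least)
qed

lemma rearr_inequality_if_bounded:
  assumes \<Omega>: "\<And>i. i < d \<Longrightarrow> \<Omega> i \<in> sets lebesgue" "\<And>i. i < d \<Longrightarrow> emeasure lebesgue (\<Omega> i) < \<infinity>"
    and fin: "emeasure (lebesgue_prod d \<Omega>) (prod_set d \<Omega>) < \<infinity>"
    and r: "0 < r" "p_min d p = ennreal r" "\<And>i. i < d \<Longrightarrow> ennreal r \<le> p i"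
    and q: "0 < q" "q \<le> v"
    and K: "0 < K" "\<And>t. 0 < t \<Longrightarrow> t < \<epsilon> \<Longrightarrow> \<kappa> t \<le> K"
  shows "rearr_inequality d \<Omega> p q \<epsilon> \<kappa> v"
proof -
  let ?M = "lebesgue_prod d \<Omega>"
  define E :: "((nat \<Rightarrow> real) \<Rightarrow> real) \<Rightarrow> real \<Rightarrow> ennreal"
    where "E = (\<lambda>f u. epowr (emeasure ?M {x \<in> space ?M. \<bar>f x\<bar> > u}) (1 / r))"
  obtain C where C: "C > 0" "\<And>A. A \<in> sets ?M \<Longrightarrow>
      epowr (emeasure ?M A) (1 / r) \<le> ennreal C * mixed_qnorm d \<Omega> p (indicator A)"
    using mixed_qnorm_indicator_lower_bound[of d \<Omega> r p, OF \<Omega> r(1,3)] by blast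
  obtain B where B: "B > 0" "\<And>E. antimono E \<Longrightarrow> E \<in> borel_measurable borel \<Longrightarrow>
      lorentz_functional v E \<le> ennreal B * lorentz_functional q E"
    using lorentz_functional_embedding[OF q] by blast
  obtain A where A: "A > 0" "\<And>f. f \<in> borel_measurable ?M \<Longrightarrow>
      weighted_rearr ?M (ennreal r) \<epsilon> \<kappa> v f \<le> ennreal A * lorentz_functional v (E f)"
  proof (cases v)
    case (real V)
    with q have "0 < ennreal V" by (metis less_le_trans)
    then have V: "0 < V" by simp
    have "weighted_rearr ?M (ennreal r) \<epsilon> \<kappa> v f \<le>
        ennreal (K * r powr (1 / V)) * lorentz_functional v (E f)" if "f \<in> borel_measurable ?M" for f
      unfolding real E_def using that fin r V K
      by (intro weighted_rearr_le_functional) (auto simp: space_lebesgue_prod)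
    then show ?thesis using K r by (intro that[of "K * r powr (1 / V)"]) auto
  next
    case top
    have "weighted_rearr ?M (ennreal r) \<epsilon> \<kappa> v f \<le> ennreal K * lorentz_functional v (E f)" for f
      using weighted_rearr_infinity_le_functional[of r K \<epsilon> \<kappa> ?M f] r K by (simp add: top E_def)
    then show ?thesis using K by (intro that[of K]) auto
  qed
  have "weighted_rearr ?M (p_min d p) \<epsilon> \<kappa> v f \<le> ennreal (A * B * C) * lorentz_qnorm d \<Omega> p q f"
    if f: "f \<in> borel_measurable ?M" for f
  proof -
    let ?N = "\<lambda>u. mixed_qnorm d \<Omega> p (indicator {x \<in> prod_set d \<Omega>. \<bar>f x\<bar> > u})"
    have anti: "antimono (E f)"
      using antimono_distribution[OF f, THEN antimonoD] r
      by (auto simp: E_def intro!: antimonoI epowr_mono)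
    have meas: "E f \<in> borel_measurable borel"
      unfolding E_def using borel_measurable_distribution[OF f] by (rule borel_measurable_epowr)
    have "ennreal (1 / C) * E f u \<le> ?N u" for u
    proof -
      have "{x \<in> space ?M. \<bar>f x\<bar> > u} \<in> sets ?M" using f by measurable
      from C(2)[OF this] have "ennreal (1 / C) * E f u \<le> ennreal (1 / C) * (ennreal C * ?N u)"
        by (intro mult_left_mono) (auto simp: E_def space_lebesgue_prod)
      also have "\<dots> = ?N u" using C by (simp flip: ennreal_mult mult.assoc)
      finally show ?thesis .
    qed
    then have "lorentz_functional q (\<lambda>u. ennreal (1 / C) * E f u) \<le> lorentz_qnorm d \<Omega> p q f"
      unfolding lorentz_qnorm_eq_functional by (intro lorentz_functional_mono)
    then have "ennreal C * (ennreal (1 / C) * lorentz_functional q (E f)) \<le> ennreal C * lorentz_qnorm d \<Omega> p q f"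
      using C meas q by (intro mult_left_mono) (simp_all add: lorentz_functional_cmult)
    then have q_le: "lorentz_functional q (E f) \<le> ennreal C * lorentz_qnorm d \<Omega> p q f"
      using C by (simp flip: ennreal_mult mult.assoc)
    have "weighted_rearr ?M (p_min d p) \<epsilon> \<kappa> v f \<le> ennreal A * lorentz_functional v (E f)"
      unfolding r(2) by (rule A(2)[OF f])
    also have "\<dots> \<le> ennreal A * (ennreal B * lorentz_functional q (E f))"
      by (intro mult_left_mono B anti meas) auto
    also have "\<dots> \<le> ennreal A * (ennreal B * (ennreal C * lorentz_qnorm d \<Omega> p q f))"
      by (intro mult_left_mono q_le) auto
    also have "\<dots> = ennreal (A * B * C) * lorentz_qnorm d \<Omega> p q f"
      using A B C by (simp add: ennreal_mult mult.assoc)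
    finally show ?thesis .
  qed
  then show ?thesis
    unfolding rearr_inequality_def lorentz_space_def using A B C
    by (intro exI[of _ "A * B * C"]) auto
qed

section \<open>Quasi-norms of boxes\<close>

definition indicator_Lp_qnorm :: "ennreal \<Rightarrow> ennreal \<Rightarrow> ennreal" where
  "indicator_Lp_qnorm p m = (if p = \<infinity> then if m = 0 then 0 else 1 else epowr m (1 / enn2real p))"

lemma Lp_qnorm_cmult_indicator:
  assumes E: "E \<in> sets M" and p: "0 < p"
  shows "Lp_qnorm M p (\<lambda>x. c * indicator E x) = c * indicator_Lp_qnorm p (emeasure M E)"
proof (cases "p = \<infinity>")
  case True
  have m: "(\<lambda>x. c * indicator E x) \<in> borel_measurable M" using E by measurable
  show ?thesis
  proof (cases "emeasure M E = 0")
    case null: True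
    then have "AE x in M. c * indicator E x \<le> 0"
      using E by (intro AE_I'[of E]) (auto split: split_indicator_asm)
    then have "esssup M (\<lambda>x. c * indicator E x) \<le> 0" using m by (rule esssup_I[rotated])
    then show ?thesis using True null by (simp add: Lp_qnorm_def indicator_Lp_qnorm_def)
  next
    case False
    have "esssup M (\<lambda>x. c * indicator E x) \<le> c"
      using m by (intro esssup_I AE_I2) (auto split: split_indicator)
    moreover have "c \<le> esssup M (\<lambda>x. c * indicator E x)"
    proof (rule ccontr)
      assume less: "\<not> c \<le> esssup M (\<lambda>x. c * indicator E x)"
      have "AE x in M. x \<notin> E"
        using esssup_AE[of "\<lambda>x. c * indicator E x" M] by eventually_elim (use less in auto)
      moreover have "{x \<in> space M. \<not> x \<notin> E} = E" using sets.sets_into_space[OF E] by auto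
      ultimately have "emeasure M E = 0"
        using AE_iff_measurable[OF E, of "\<lambda>x. x \<notin> E"] by simp
      then show False using False by simp
    qed
    ultimately show ?thesis using True False by (simp add: Lp_qnorm_def indicator_Lp_qnorm_def)
  qed
next
  case False
  define P where "P = enn2real p"
  have P: "0 < P" using False p by (simp add: P_def enn2real_positive_iff less_top[symmetric])
  have "(\<integral>\<^sup>+ x. epowr (c * indicator E x) P \<partial>M) = (\<integral>\<^sup>+ x. epowr c P * indicator E x \<partial>M)"
    by (intro nn_integral_cong) (auto split: split_indicator)
  also have "\<dots> = epowr c P * emeasure M E" using E by (simp add: nn_integral_cmult_indicator)
  finally show ?thesis
    using False P by (simp add: Lp_qnorm_def indicator_Lp_qnorm_def P_def[symmetric] epowr_mult)
qed

text \<open>Taking the quasi-norm in one variable of a box leaves a constant times the indicator of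
  the remaining box. Carrying that indicator along keeps the induction within the functions covered
  by \<open>Lp_qnorm_cmult_indicator\<close>.\<close>

lemma iter_qnorm_box:
  assumes E: "\<And>i. i < d \<Longrightarrow> E i \<in> sets lebesgue" "\<And>i. i < d \<Longrightarrow> E i \<subseteq> \<Omega> i"
    and \<Omega>: "\<And>i. i < d \<Longrightarrow> \<Omega> i \<in> sets lebesgue" and p: "\<And>i. i < d \<Longrightarrow> 0 < p i"
    and k: "k \<le> d" and x: "x \<in> extensional {k..<d}"
  shows "iter_qnorm \<Omega> p k (indicator (Pi\<^sub>E {..<d} E)) x =
    (\<Prod>i<k. indicator_Lp_qnorm (p i) (emeasure lebesgue (E i))) * indicator (Pi\<^sub>E {k..<d} E) x"
  using k x
proof (induction k arbitrary: x)
  case 0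
  then show ?case by (simp add: atLeast0LessThan)
next
  case (Suc k)
  let ?P = "\<Prod>i<k. indicator_Lp_qnorm (p i) (emeasure lebesgue (E i))"
  have k: "k < d" using Suc.prems by simp
  have Ek: "E k \<in> sets (lebesgue_on (\<Omega> k))"
    using E[OF k] \<Omega>[OF k] by (subst sets_restrict_space_iff) auto
  have "iter_qnorm \<Omega> p k (indicator (Pi\<^sub>E {..<d} E)) (x(k := t)) =
      ?P * indicator (Pi\<^sub>E {Suc k..<d} E) x * indicator (E k) t" for t
  proof -
    have "x(k := t) \<in> extensional {k..<d}"
      using Suc.prems k by (auto simp: extensional_def)
    then have "iter_qnorm \<Omega> p k (indicator (Pi\<^sub>E {..<d} E)) (x(k := t)) =
        ?P * indicator (Pi\<^sub>E {k..<d} E) (x(k := t))"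
      by (rule Suc.IH[OF less_imp_le[OF k]])
    also have "x(k := t) \<in> Pi\<^sub>E {k..<d} E \<longleftrightarrow> x \<in> Pi\<^sub>E {Suc k..<d} E \<and> t \<in> E k"
    proof -
      have "{k..<d} = insert k {Suc k..<d}" using k by auto
      then show ?thesis using Suc.prems by (auto simp: PiE_iff extensional_def)
    qed
    then have "indicator (Pi\<^sub>E {k..<d} E) (x(k := t)) =
        (indicator (Pi\<^sub>E {Suc k..<d} E) x * indicator (E k) t :: ennreal)"
      by (auto split: split_indicator)
    finally show ?thesis by (simp only: mult.assoc)
  qed
  then have "iter_qnorm \<Omega> p (Suc k) (indicator (Pi\<^sub>E {..<d} E)) x =
      ?P * indicator (Pi\<^sub>E {Suc k..<d} E) x *
      indicator_Lp_qnorm (p k) (emeasure (lebesgue_on (\<Omega> k)) (E k))"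
    using Lp_qnorm_cmult_indicator[OF Ek p[OF k]] by simp
  also have "emeasure (lebesgue_on (\<Omega> k)) (E k) = emeasure lebesgue (E k)"
    using E[OF k] \<Omega>[OF k] by (intro emeasure_restrict_space) auto
  finally show ?case by (simp add: mult_ac)
qed

lemma mixed_qnorm_box:
  assumes "\<And>i. i < d \<Longrightarrow> E i \<in> sets lebesgue" "\<And>i. i < d \<Longrightarrow> E i \<subseteq> \<Omega> i"
    and "\<And>i. i < d \<Longrightarrow> \<Omega> i \<in> sets lebesgue" and "\<And>i. i < d \<Longrightarrow> 0 < p i"
  shows "mixed_qnorm d \<Omega> p (indicator (Pi\<^sub>E {..<d} E)) =
    (\<Prod>i<d. indicator_Lp_qnorm (p i) (emeasure lebesgue (E i)))"
proof -
  have "(\<lambda>x. ennreal \<bar>indicator (Pi\<^sub>E {..<d} E) x\<bar>) = indicator (Pi\<^sub>E {..<d} E)"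
    by (auto simp: fun_eq_iff split: split_indicator)
  then show ?thesis
    using iter_qnorm_box[OF assms, where k = d and x = "\<lambda>_. undefined"] by (simp add: mixed_qnorm_def)
qed

section \<open>Level sets of prescribed measure\<close>

text \<open>The Borel main part of \<open>S\<close> is the increasing union of its intersections
  with [-n, n], so one of these has positive measure. Bounded support and finite measure are what a
  distribution function on the set requires.\<close>

lemma bounded_borel_subset_pos_measure:
  fixes S :: "real set"
  assumes S: "S \<in> sets lebesgue" "0 < emeasure lebesgue S"
  obtains C c b where "C \<in> sets borel" "C \<subseteq> S" "C \<subseteq> {-b..b}" "emeasure lborel C = ennreal c" "0 < c" "0 < b"
proof -
  define B where "B = main_part lborel S"
  have B: "B \<in> sets borel" "B \<subseteq> S" "emeasure lborel B > 0"
    using S main_part_null_part_Un[of S lborel] main_part_sets[of S lborel] unfolding B_def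
    by (simp_all, blast)
  have "\<exists>n::nat. emeasure lborel (B \<inter> {- real n..real n}) \<noteq> 0"
  proof (rule ccontr)
    assume "\<not> ?thesis"
    then have "emeasure lborel (\<Union>n::nat. B \<inter> {- real n..real n}) = 0"
      using B by (intro emeasure_UN_eq_0) auto
    moreover have "(\<Union>n::nat. B \<inter> {- real n..real n}) = B"
    proof (safe, simp)
      fix x assume "x \<in> B"
      moreover obtain n where "\<bar>x\<bar> \<le> real n" using real_arch_simple by blast
      ultimately show "\<exists>n. - real n \<le> x \<and> x \<le> real n" by (intro exI[of _ n]) auto
    qed
    ultimately show False using B by simp
  qed
  then obtain n :: nat where n: "emeasure lborel (B \<inter> {- real n..real n}) \<noteq> 0" ..
  have "emeasure lborel (B \<inter> {- real n..real n}) \<le> emeasure lborel {- real n..real n}"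
    using B by (intro emeasure_mono) auto
  then have fin: "emeasure lborel (B \<inter> {- real n..real n}) < top" by (auto simp: le_less_trans)
  show ?thesis
  proof (rule that)
    show "emeasure lborel (B \<inter> {- real n..real n}) =
        ennreal (enn2real (emeasure lborel (B \<inter> {- real n..real n})))"
      using fin by simp
    show "0 < enn2real (emeasure lborel (B \<inter> {- real n..real n}))"
      using fin n by (simp add: enn2real_positive_iff zero_less_iff_neq_zero)
    show "B \<inter> {- real n..real n} \<subseteq> {- (real n + 1)..real n + 1}" by auto
  qed (use B in auto)
qed

text \<open>\<open>F\<close> is the distribution function of Lebesgue measure on \<open>C\<close>; since it is continuous, it pushes
  that measure forward to the uniform distribution.\<close>

lemma level_function:
  fixes C :: "real set"
  assumes C: "C \<in> sets borel" "C \<subseteq> {-b..b}" and c: "emeasure lborel C = ennreal c" "0 < c" "0 < b"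
  obtains F :: "real \<Rightarrow> real" where "F \<in> borel_measurable borel" "\<And>x. 0 \<le> F x"
    "\<And>s. 0 < s \<Longrightarrow> s < c \<Longrightarrow> emeasure lborel {x \<in> C. F x < s} = ennreal s"
proof -
  have CL: "C \<in> lmeasurable"
    using C c by (auto simp: fmeasurable_def)
  have lm [simp]: "C \<inter> {..x} \<in> lmeasurable" "C \<inter> {..<x} \<in> lmeasurable" for x
    using CL by (auto intro: fmeasurable_Int_fmeasurable)
  define F where "F = (\<lambda>x. measure lebesgue (C \<inter> {..x}))"
  have mono: "F x \<le> F y" if "x \<le> y" for x y
    unfolding F_def using that by (intro measure_mono_fmeasurable) (auto simp: fmeasurableD)
  \<comment> \<open>The length of an interval bounds the growth of \<open>F\<close> on it, so
    \<open>F\<close> is 1-Lipschitz, and the intermediate value theorem reaches every level.\<close>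
  have lip: "F y - F x \<le> y - x" if "x \<le> y" for x y
  proof -
    have "F y \<le> measure lebesgue (C \<inter> {..x} \<union> {x..y})"
      unfolding F_def by (intro measure_mono_fmeasurable) (auto simp: fmeasurableD intro!: fmeasurable.Un)
    also have "\<dots> \<le> F x + measure lebesgue {x..y}"
      unfolding F_def by (intro measure_Un_le) (auto simp: fmeasurableD)
    finally show ?thesis using that by simp
  qed
  have cont: "continuous_on UNIV F"
  proof (rule continuous_onI)
    fix x e :: real assume "0 < e"
    then show "\<exists>d>0. \<forall>y\<in>UNIV. dist y x < d \<longrightarrow> dist (F y) (F x) \<le> e"
    proof (intro exI[of _ e] conjI ballI impI)
      fix y assume "dist y x < e"
      then show "dist (F y) (F x) \<le> e"
        using lip[of x y] lip[of y x] mono[of x y] mono[of y x]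
        by (cases "x \<le> y") (auto simp: dist_real_def)
    qed
  qed
  \<comment> \<open>The point -b - 1 lies strictly left of \<open>C\<close>, so that
    \<open>F\<close> starts exactly at 0.\<close>
  have F0: "F (- b - 1) = 0"
  proof -
    have "C \<inter> {..- b - 1} = {}" using C c by force
    then show ?thesis by (simp add: F_def)
  qed
  have Fb: "F b = c"
  proof -
    have "C \<inter> {..b} = C" using C by auto
    then show ?thesis using C c by (simp add: F_def measure_def)
  qed
  have attain: "\<exists>x. F x = s" if "0 < s" "s < c" for s
    using IVT'[of F "- b - 1" s b] that F0 Fb c continuous_on_subset[OF cont] by auto
  have meas: "F \<in> borel_measurable borel"
    using cont by (rule borel_measurable_continuous_onI)
  have sets: "{x \<in> C. F x < s} \<in> sets borel" for s
    using C meas by measurable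
  show ?thesis
  proof (rule that[of F])
    fix s assume s: "0 < s" "s < c"
    then obtain R where R: "F R = s" using attain by blast
    have eF: "emeasure lborel (C \<inter> {..x}) = ennreal (F x)" for x
    proof -
      have "emeasure lebesgue (C \<inter> {..x}) = ennreal (F x)"
        unfolding F_def by (rule emeasure_eq_measure2) simp
      then show ?thesis using C by simp
    qed
    show "emeasure lborel {x \<in> C. F x < s} = ennreal s"
    proof (rule antisym)
      have "{x \<in> C. F x < s} \<subseteq> C \<inter> {..R}"
      proof safe
        fix x assume "F x < s"
        then show "x \<le> R" using mono[of R x] R by (cases "R \<le> x") auto
      qed
      then have "emeasure lborel {x \<in> C. F x < s} \<le> emeasure lborel (C \<inter> {..R})"
        using C by (intro emeasure_mono) auto
      then show "emeasure lborel {x \<in> C. F x < s} \<le> ennreal s" by (simp add: eF R)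
      \<comment> \<open>The strict sublevel set leaves out the points of \<open>C\<close> with F =
        s. Every level s' < s fits inside it, and these levels exhaust the measure.\<close>
      show "ennreal s \<le> emeasure lborel {x \<in> C. F x < s}"
      proof (rule dense_le)
        fix y assume "y < ennreal s"
        then obtain s' where s': "y = ennreal s'" "0 \<le> s'" "s' < s"
          by (cases y) (auto simp: ennreal_less_iff)
        show "y \<le> emeasure lborel {x \<in> C. F x < s}"
        proof (cases "s' = 0")
          case False
          then obtain R' where R': "F R' = s'" using attain[of s'] s' s by auto
          have "emeasure lborel (C \<inter> {..R'}) \<le> emeasure lborel {x \<in> C. F x < s}"
          proof (rule emeasure_mono)
            show "C \<inter> {..R'} \<subseteq> {x \<in> C. F x < s}"
              using mono[of _ R'] R' s' by (auto intro: le_less_trans)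
          qed (use sets in auto)
          then show ?thesis using s' by (simp add: eF R')
        qed (use s' in auto)
      qed
    qed
  qed (use meas in \<open>auto simp: F_def\<close>)
qed

section \<open>Necessity\<close>

text \<open>All that necessity uses about the test sets. The truncation
  \<open>max 0 (min s c)\<close> lets the quasi-norm bound hold for every real s: a nonpositive
  level gives the empty set, whose quasi-norm must be 0, and beyond level \<open>c\<close> the bound
  no longer grows.\<close>

locale level_sets =
  fixes d :: nat and \<Omega> :: "nat \<Rightarrow> real set" and p :: "nat \<Rightarrow> ennreal" and r :: real
    and S :: "(nat \<Rightarrow> real) set" and G :: "(nat \<Rightarrow> real) \<Rightarrow> real" and L K c :: real
  assumes r_pos: "0 < r" and p_min_eq: "p_min d p = ennreal r"
    and L_pos: "0 < L" and K_pos: "0 < K" and c_pos: "0 < c"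
    and S_sets [measurable]: "S \<in> sets (lebesgue_prod d \<Omega>)"
    and G_measurable [measurable]: "G \<in> borel_measurable (lebesgue_prod d \<Omega>)"
    and G_nonneg: "0 \<le> G x"
    and emeasure_level: "0 < s \<Longrightarrow> s < c \<Longrightarrow>
      emeasure (lebesgue_prod d \<Omega>) {x \<in> S. G x < s} = ennreal (L * s)"
    and qnorm_level: "mixed_qnorm d \<Omega> p (indicator {x \<in> S. G x < s}) \<le>
      ennreal (K * max 0 (min s c) powr (1 / r))"

lemma level_sets_exist:
  assumes d: "d \<ge> 1" and \<Omega>: "\<And>i. i < d \<Longrightarrow> \<Omega> i \<in> sets lebesgue"
    "\<And>i. i < d \<Longrightarrow> emeasure lebesgue (\<Omega> i) > 0"
    and p: "\<And>i. i < d \<Longrightarrow> 0 < p i" and r: "p_min d p = ennreal r" "0 < r"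
  obtains S G L K c where "level_sets d \<Omega> p r S G L K c"
proof -
  have "p_min d p \<in> p ` {..<d}"
    unfolding p_min_def using d by (intro Min_in) (auto simp: lessThan_empty_iff)
  then obtain j where j: "j < d" "p j = ennreal r" using r by auto
  have "\<forall>i\<in>{..<d}. \<exists>C. C \<in> sets borel \<and> C \<subseteq> \<Omega> i \<and> (\<exists>b>0. C \<subseteq> {-b..b}) \<and>
      (\<exists>c>0. emeasure lborel C = ennreal c)"
    using bounded_borel_subset_pos_measure[OF \<Omega>] by (metis lessThan_iff)
  from bchoice[OF this] obtain C where C': "\<forall>i\<in>{..<d}. C i \<in> sets borel \<and> C i \<subseteq> \<Omega> i \<and>
      (\<exists>b>0. C i \<subseteq> {-b..b}) \<and> (\<exists>c>0. emeasure lborel (C i) = ennreal c)" ..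
  define c where "c = (\<lambda>i. enn2real (emeasure lborel (C i)))"
  have C: "C i \<in> sets borel" "C i \<subseteq> \<Omega> i" "emeasure lborel (C i) = ennreal (c i)" "0 < c i" if "i < d" for i
  proof -
    obtain e where "0 < e" "emeasure lborel (C i) = ennreal e" using C' \<open>i < d\<close> by blast
    then have "c i = e" by (simp only: c_def enn2real_ennreal less_imp_le)
    with \<open>0 < e\<close> \<open>emeasure lborel (C i) = ennreal e\<close>
    show "emeasure lborel (C i) = ennreal (c i)" "0 < c i" by simp_all
    show "C i \<in> sets borel" "C i \<subseteq> \<Omega> i" using C' \<open>i < d\<close> by blast+
  qed
  obtain b where b: "0 < b" "C j \<subseteq> {-b..b}" using C' j by blast
  obtain F :: "real \<Rightarrow> real" where F: "F \<in> borel_measurable borel" "\<And>x. 0 \<le> F x"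
    "\<And>s. 0 < s \<Longrightarrow> s < c j \<Longrightarrow> emeasure lborel {x \<in> C j. F x < s} = ennreal s"
    using level_function[OF C(1)[OF j(1)] b(2) C(3,4)[OF j(1)] b(1)] by blast
  let ?P = "Pi\<^sub>M {..<d} (\<lambda>_. lborel :: real measure)"
  define J where "J = {..<d} - {j}"
  \<comment> \<open>The coordinates other than \<open>j\<close> contribute constants only:
    \<open>L\<close> is the product of their measures, and the \<open>k i\<close> are their
    quasi-norms. With an infinite exponent, a set of positive measure has quasi-norm 1.\<close>
  define L where "L = (\<Prod>i\<in>J. c i)"
  define k where "k = (\<lambda>i. if p i = \<infinity> then 1 else c i powr (1 / enn2real (p i)))"
  define E where "E = (\<lambda>s i. if i = j then {x \<in> C j. F x < s} else C i)"
  have split: "{..<d} = insert j J" "finite J" "j \<notin> J" using j by (auto simp: J_def)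
  have Fs: "{x \<in> C j. F x < s} \<in> sets borel" for s using C(1)[OF j(1)] F(1) by measurable
  have E: "E s i \<in> sets borel" "E s i \<subseteq> \<Omega> i" if "i < d" for s i
    using C[OF that] Fs by (auto simp: E_def)
  have box: "{x \<in> Pi\<^sub>E {..<d} C. F (x j) < s} = Pi\<^sub>E {..<d} (E s)" for s
  proof -
    have "(\<forall>i\<in>{..<d}. x i \<in> E s i) \<longleftrightarrow> (\<forall>i\<in>{..<d}. x i \<in> C i) \<and> F (x j) < s" for x
    proof (intro iffI conjI ballI)
      fix i assume "\<forall>i\<in>{..<d}. x i \<in> E s i" "i \<in> {..<d}"
      then have "x i \<in> E s i" by blast
      then show "x i \<in> C i" by (simp add: E_def split: if_splits)
    next
      assume "\<forall>i\<in>{..<d}. x i \<in> E s i"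
      with j(1) have "x j \<in> E s j" by blast
      then show "F (x j) < s" by (simp add: E_def)
    qed (simp add: E_def)
    then show ?thesis by (simp only: PiE_iff set_eq_iff mem_Collect_eq) blast
  qed
  have sub: "Pi\<^sub>E {..<d} (E s) \<subseteq> prod_set d \<Omega>" for s
    unfolding prod_set_def using E by (intro PiE_mono) auto
  have subC: "Pi\<^sub>E {..<d} C \<subseteq> prod_set d \<Omega>"
    unfolding prod_set_def using C by (intro PiE_mono) auto
  have em: "emeasure (lebesgue_prod d \<Omega>) (Pi\<^sub>E {..<d} (E s)) = emeasure lborel (E s j) * ennreal L" for s
  proof -
    have "Pi\<^sub>E {..<d} (E s) \<in> sets ?P" using E by (intro sets_PiM_I_finite) auto
    then have "emeasure (lebesgue_prod d \<Omega>) (Pi\<^sub>E {..<d} (E s)) = emeasure ?P (Pi\<^sub>E {..<d} (E s))"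
      using emeasure_lebesgue_prod[of d \<Omega>, OF _ sub] \<Omega>(1) by simp
    also have "\<dots> = (\<Prod>i<d. emeasure lborel (E s i))"
      using E by (intro lborel_prod.emeasure_PiM) auto
    also have "\<dots> = emeasure lborel (E s j) * (\<Prod>i\<in>J. emeasure lborel (E s i))"
      using split by simp
    also have "(\<Prod>i\<in>J. emeasure lborel (E s i)) = (\<Prod>i\<in>J. ennreal (c i))"
      using C by (intro prod.cong) (auto simp: E_def J_def)
    also have "\<dots> = ennreal L"
      unfolding L_def using C by (intro prod_ennreal) (auto simp: J_def less_imp_le)
    finally show ?thesis .
  qed
  show ?thesis
  proof (rule that[of "Pi\<^sub>E {..<d} C" "\<lambda>x. F (x j)" L "\<Prod>i\<in>J. k i" "c j"], unfold_locales)
    show "0 < r" "p_min d p = ennreal r" "0 < c j" "\<And>x. 0 \<le> F (x j)"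
      using r C j F by auto
    show "0 < L" unfolding L_def using C by (intro prod_pos) (auto simp: J_def)
    show "0 < (\<Prod>i\<in>J. k i)"
      using C by (intro prod_pos) (auto simp: J_def k_def, fastforce)
    show "Pi\<^sub>E {..<d} C \<in> sets (lebesgue_prod d \<Omega>)"
      using subC C \<Omega>(1) by (subst sets_lebesgue_prod_iff) (auto intro!: sets_completionI_sets sets_PiM_I_finite)
    have "(\<lambda>x. x j) \<in> measurable ?P lborel"
      using j(1) by (intro measurable_component_singleton) simp
    then have "(\<lambda>x. F (x j)) \<in> borel_measurable ?P"
      by (rule measurable_compose) (simp add: F)
    then show "(\<lambda>x. F (x j)) \<in> borel_measurable (lebesgue_prod d \<Omega>)"
      unfolding lebesgue_prod_def by (intro measurable_restrict_space1 measurable_completion)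
    show "emeasure (lebesgue_prod d \<Omega>) {x \<in> Pi\<^sub>E {..<d} C. F (x j) < s} = ennreal (L * s)"
      if "0 < s" "s < c j" for s
      unfolding box em using F(3)[OF that] that by (simp add: E_def mult.commute ennreal_mult'')
    show "mixed_qnorm d \<Omega> p (indicator {x \<in> Pi\<^sub>E {..<d} C. F (x j) < s}) \<le>
        ennreal ((\<Prod>i\<in>J. k i) * max 0 (min s (c j)) powr (1 / r))" for s
    proof -
      have le: "emeasure lborel (E s j) \<le> ennreal (max 0 (min s (c j)))"
      proof -
        consider "s \<le> 0" | "0 < s" "s < c j" | "c j \<le> s" "0 < s" by linarith
        then show ?thesis
        proof cases
          case 1
          then have "E s j = {}" using F(2) by (auto simp: E_def not_less intro: order_trans)
          then show ?thesis by simp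
        next
          case 2
          then show ?thesis using F(3) by (simp add: E_def)
        next
          case 3
          have "emeasure lborel (E s j) \<le> emeasure lborel (C j)"
            using C(1)[OF j(1)] by (intro emeasure_mono) (auto simp: E_def)
          then show ?thesis using 3 C(3,4)[OF j(1)] by (simp add: min_absorb2)
        qed
      qed
      have "mixed_qnorm d \<Omega> p (indicator (Pi\<^sub>E {..<d} (E s))) =
          (\<Prod>i<d. indicator_Lp_qnorm (p i) (emeasure lebesgue (E s i)))"
        using E \<Omega>(1) p by (intro mixed_qnorm_box) auto
      also have "\<dots> = (\<Prod>i<d. indicator_Lp_qnorm (p i) (emeasure lborel (E s i)))"
        using E by (intro prod.cong) auto
      also have "\<dots> = indicator_Lp_qnorm (p j) (emeasure lborel (E s j)) *
          (\<Prod>i\<in>J. indicator_Lp_qnorm (p i) (emeasure lborel (E s i)))"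
        using split by simp
      also have "(\<Prod>i\<in>J. indicator_Lp_qnorm (p i) (emeasure lborel (E s i))) = (\<Prod>i\<in>J. ennreal (k i))"
      proof (intro prod.cong refl)
        fix i assume i: "i \<in> J"
        then have "emeasure lborel (E s i) = ennreal (c i)" "0 < c i"
          using C by (auto simp: E_def J_def)
        then show "indicator_Lp_qnorm (p i) (emeasure lborel (E s i)) = ennreal (k i)"
          by (auto simp: indicator_Lp_qnorm_def k_def epowr_ennreal)
      qed
      also have "\<dots> = ennreal (\<Prod>i\<in>J. k i)"
        by (intro prod_ennreal) (auto simp: k_def)
      also have "indicator_Lp_qnorm (p j) (emeasure lborel (E s j)) = epowr (emeasure lborel (E s j)) (1 / r)"
        using j r by (simp add: indicator_Lp_qnorm_def)
      also have "epowr (emeasure lborel (E s j)) (1 / r) * ennreal (\<Prod>i\<in>J. k i) \<le>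
          epowr (ennreal (max 0 (min s (c j)))) (1 / r) * ennreal (\<Prod>i\<in>J. k i)"
        using r le by (intro mult_right_mono epowr_mono) auto
      also have "\<dots> = ennreal ((\<Prod>i\<in>J. k i) * max 0 (min s (c j)) powr (1 / r))"
        using \<open>0 < (\<Prod>i\<in>J. k i)\<close> by (simp add: epowr_ennreal ennreal_mult mult.commute)
      finally show ?thesis unfolding box .
    qed
  qed
qed

text \<open>The indicator of a set A exceeds u exactly on A for 0 < u < 1, and nowhere for u >= 1.
  The Lorentz quasi-norm of an indicator is therefore a multiple of the value bounded here.\<close>

lemma lorentz_functional_indicator:
  assumes q: "0 < q"
  obtains Q where "Q > 0" "lorentz_functional q (indicator {..<1}) \<le> ennreal Q"
proof (cases "q = \<infinity>")
  case True
  then have "lorentz_functional q (indicator {..<1}) \<le> ennreal 1"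
    by (auto simp: lorentz_functional_def intro!: SUP_least split: split_indicator)
  then show ?thesis by (intro that[of 1]) auto
next
  case False
  define Q where "Q = enn2real q"
  have Q: "0 < Q" using False q by (simp add: Q_def enn2real_positive_iff less_top[symmetric])
  have "(\<integral>\<^sup>+ u\<in>{0<..}. ennreal (u powr Q) * epowr (indicator {..<1} u) Q * ennreal (1 / u) \<partial>lborel) =
      (\<integral>\<^sup>+ u\<in>{0<..<1}. ennreal (u powr (Q - 1)) \<partial>lborel)"
    by (intro nn_integral_cong) (auto simp: powr_diff split: split_indicator simp flip: ennreal_mult)
  also have "\<dots> = ennreal (1 / Q)" using Q by (subst nn_integral_powr_from_0) auto
  finally have "lorentz_functional q (indicator {..<1}) = ennreal ((1 / Q) powr (1 / Q))"
    using False Q by (simp add: lorentz_functional_def Q_def[symmetric] epowr_ennreal)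
  then show ?thesis using Q by (intro that[of "(1 / Q) powr (1 / Q)"]) auto
qed

context level_sets
begin

lemma level_measurable [measurable]: "{x \<in> S. G x < s} \<in> sets (lebesgue_prod d \<Omega>)"
proof -
  have "{x \<in> S. G x < s} = S \<inter> {x \<in> space (lebesgue_prod d \<Omega>). G x < s}"
    using sets.sets_into_space[OF S_sets] by auto
  then show ?thesis by simp
qed

lemma S_subset: "S \<subseteq> prod_set d \<Omega>"
  using sets.sets_into_space[OF S_sets] by (simp add: space_lebesgue_prod)

lemma mixed_qnorm_indicator_empty: "mixed_qnorm d \<Omega> p (indicator {}) = 0"
proof -
  have "{x \<in> S. G x < 0} = {}" using G_nonneg by (auto simp: not_less)
  from qnorm_level[of 0, unfolded this] c_pos show ?thesis by simp
qed

lemma lorentz_qnorm_indicator_level: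
  assumes "0 < q"
  obtains Q where "Q > 0" "\<And>s. 0 < s \<Longrightarrow> s < c \<Longrightarrow> indicator {x \<in> S. G x < s} \<in> lorentz_space d \<Omega> p q"
    "\<And>s. 0 < s \<Longrightarrow> s < c \<Longrightarrow>
      lorentz_qnorm d \<Omega> p q (indicator {x \<in> S. G x < s}) \<le> ennreal (Q * s powr (1 / r))"
proof -
  obtain Q where Q: "Q > 0" "lorentz_functional q (indicator {..<1}) \<le> ennreal Q"
    using lorentz_functional_indicator[OF assms] .
  have *: "lorentz_qnorm d \<Omega> p q (indicator {x \<in> S. G x < s}) \<le> ennreal (Q * K * s powr (1 / r))"
    if s: "0 < s" "s < c" for s
  proof -
    let ?A = "{x \<in> S. G x < s}"
    have "mixed_qnorm d \<Omega> p (indicator {x \<in> prod_set d \<Omega>. \<bar>indicator ?A x\<bar> > u}) \<le>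
        ennreal (K * s powr (1 / r)) * indicator {..<1} u" if "0 < u" for u :: real
    proof (cases "u < 1")
      case True
      then have level: "{x \<in> prod_set d \<Omega>. \<bar>indicator ?A x\<bar> > u} = ?A"
        using that S_subset by (auto split: split_indicator split_indicator_asm)
      show ?thesis unfolding level using qnorm_level[of s] s True by simp
    next
      case False
      then have empty: "{x \<in> prod_set d \<Omega>. \<bar>indicator ?A x\<bar> > u} = {}"
        by (auto split: split_indicator split_indicator_asm)
      show ?thesis unfolding empty mixed_qnorm_indicator_empty by simp
    qed
    then have "lorentz_qnorm d \<Omega> p q (indicator ?A) \<le>
        lorentz_functional q (\<lambda>u. ennreal (K * s powr (1 / r)) * indicator {..<1} u)"
      unfolding lorentz_qnorm_eq_functional by (intro lorentz_functional_mono)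
    also have "\<dots> = ennreal (K * s powr (1 / r)) * lorentz_functional q (indicator {..<1})"
      using K_pos assms by (intro lorentz_functional_cmult) auto
    also have "\<dots> \<le> ennreal (K * s powr (1 / r)) * ennreal Q"
      by (intro mult_left_mono Q) auto
    also have "\<dots> = ennreal (Q * K * s powr (1 / r))"
      using K_pos Q by (simp add: mult_ac flip: ennreal_mult)
    finally show ?thesis .
  qed
  show ?thesis
  proof (rule that[of "Q * K"])
    show "indicator {x \<in> S. G x < s} \<in> lorentz_space d \<Omega> p q" if "0 < s" "s < c" for s
      using *[OF that] by (auto simp: lorentz_space_def intro: le_less_trans)
  qed (use Q K_pos * in auto)
qed

lemma rearrangement_indicator_level:
  assumes "0 < s" "s < c" "t < L * s"
  shows "1 \<le> rearrangement (lebesgue_prod d \<Omega>) (indicator {x \<in> S. G x < s}) t"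
proof -
  \<comment> \<open>Heights below 1 are used because an indicator never exceeds 1 strictly.\<close>
  have *: "ennreal u \<le> rearrangement (lebesgue_prod d \<Omega>) (indicator {x \<in> S. G x < s}) t"
    if u: "0 < u" "u < 1" for u
  proof (rule rearrangement_ge)
    have "{x \<in> space (lebesgue_prod d \<Omega>). u < \<bar>indicator {x \<in> S. G x < s} x :: real\<bar>} = {x \<in> S. G x < s}"
      using u S_subset by (auto simp: space_lebesgue_prod split: split_indicator split_indicator_asm)
    then show "ennreal t < emeasure (lebesgue_prod d \<Omega>)
        {x \<in> space (lebesgue_prod d \<Omega>). u < \<bar>indicator {x \<in> S. G x < s} x\<bar>}"
      using assms L_pos by (simp add: emeasure_level ennreal_lessI)
  qed measurable
  show ?thesis
  proof (rule dense_le)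
    fix y :: ennreal assume "y < 1"
    then obtain u where "y = ennreal u" "0 \<le> u" "u < 1" by (cases y) (auto simp: ennreal_less_iff)
    then show "y \<le> rearrangement (lebesgue_prod d \<Omega>) (indicator {x \<in> S. G x < s}) t"
      using *[of u] by (cases "u = 0") simp_all
  qed
qed

section \<open>Boundedness of the weight\<close>

lemma bounded_if_rearr_inequality_sup:
  assumes q: "0 < q" and \<epsilon>: "0 < \<epsilon>" "\<epsilon> \<le> L * c / 2"
    and \<kappa>: "\<And>t. 0 < t \<Longrightarrow> t < \<epsilon> \<Longrightarrow> 0 \<le> \<kappa> t"
    and ineq: "rearr_inequality d \<Omega> p q \<epsilon> \<kappa> \<infinity>"
  obtains B where "\<And>t. 0 < t \<Longrightarrow> t < \<epsilon> \<Longrightarrow> \<kappa> t \<le> B"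
proof -
  obtain Q where Q: "Q > 0" "\<And>s. 0 < s \<Longrightarrow> s < c \<Longrightarrow> indicator {x \<in> S. G x < s} \<in> lorentz_space d \<Omega> p q"
    "\<And>s. 0 < s \<Longrightarrow> s < c \<Longrightarrow>
      lorentz_qnorm d \<Omega> p q (indicator {x \<in> S. G x < s}) \<le> ennreal (Q * s powr (1 / r))"
    using lorentz_qnorm_indicator_level[OF q] by blast
  obtain a where a: "a > 0" "\<And>f. f \<in> lorentz_space d \<Omega> p q \<Longrightarrow>
      weighted_rearr (lebesgue_prod d \<Omega>) (p_min d p) \<epsilon> \<kappa> \<infinity> f \<le> ennreal a * lorentz_qnorm d \<Omega> p q f"
    using ineq unfolding rearr_inequality_def by blast
  show ?thesis
  proof (rule that[of "a * Q * (2 / L) powr (1 / r)"])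
    fix t assume t: "0 < t" "t < \<epsilon>"
    \<comment> \<open>The level set then has measure 2t, strictly more than t, and s < c follows
      from \<open>\<epsilon> \<le> L * c / 2\<close>.\<close>
    define s where "s = 2 * t / L"
    have s: "0 < s" "s < c" "t < L * s"
      using t \<epsilon> L_pos by (auto simp: s_def field_simps)
    let ?f = "indicator {x \<in> S. G x < s} :: _ \<Rightarrow> real"
    have "ennreal (\<kappa> t * t powr (1 / r)) * 1 \<le>
        ennreal (\<kappa> t * t powr (1 / r)) * rearrangement (lebesgue_prod d \<Omega>) ?f t"
      by (intro mult_left_mono rearrangement_indicator_level s) auto
    also have "\<dots> \<le> weighted_rearr (lebesgue_prod d \<Omega>) (p_min d p) \<epsilon> \<kappa> \<infinity> ?f"
      unfolding weighted_rearr_def Let_def using t r_pos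
      by (auto simp: p_min_eq intro!: SUP_upper2[of t])
    also have "\<dots> \<le> ennreal a * lorentz_qnorm d \<Omega> p q ?f"
      by (intro a Q s)
    also have "\<dots> \<le> ennreal a * ennreal (Q * s powr (1 / r))"
      by (intro mult_left_mono Q s) auto
    also have "\<dots> = ennreal (a * Q * (2 / L) powr (1 / r) * t powr (1 / r))"
      using a Q t L_pos by (simp add: s_def powr_mult powr_divide mult_ac flip: ennreal_mult)
    finally have "\<kappa> t * t powr (1 / r) \<le> a * Q * (2 / L) powr (1 / r) * t powr (1 / r)"
      unfolding mult_1_right by (rule iffD1[OF ennreal_le_iff, rotated]) (use a Q in auto)
    then show "\<kappa> t \<le> a * Q * (2 / L) powr (1 / r)" using t by simp
  qed
qed

text \<open>A set of measure \<tau> detects the value \<open>\<kappa> \<tau>\<close>. For t < \<tau>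
  the rearrangement of its indicator is at least 1 and, by monotonicity, the weight is at least
  \<open>\<kappa> \<tau>\<close>. The left-hand side is then at least a multiple of
  \<open>\<kappa> \<tau>\<close> times \<tau>^(1/r), and this power cancels against the quasi-norm
  of the set.\<close>

lemma bounded_if_rearr_inequality_integral:
  assumes q: "0 < q" and V: "0 < V" and \<epsilon>: "0 < \<epsilon>" "\<epsilon> \<le> L * c / 2"
    and \<kappa>: "\<And>t. 0 < t \<Longrightarrow> t \<le> \<epsilon> \<Longrightarrow> 0 < \<kappa> t"
    "\<And>s t. 0 < s \<Longrightarrow> s \<le> t \<Longrightarrow> t \<le> \<epsilon> \<Longrightarrow> \<kappa> t \<le> \<kappa> s"
    and ineq: "rearr_inequality d \<Omega> p q \<epsilon> \<kappa> (ennreal V)"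
  obtains B where "\<And>t. 0 < t \<Longrightarrow> t \<le> \<epsilon> \<Longrightarrow> \<kappa> t \<le> B"
proof -
  obtain Q where Q: "Q > 0" "\<And>s. 0 < s \<Longrightarrow> s < c \<Longrightarrow> indicator {x \<in> S. G x < s} \<in> lorentz_space d \<Omega> p q"
    "\<And>s. 0 < s \<Longrightarrow> s < c \<Longrightarrow>
      lorentz_qnorm d \<Omega> p q (indicator {x \<in> S. G x < s}) \<le> ennreal (Q * s powr (1 / r))"
    using lorentz_qnorm_indicator_level[OF q] by blast
  obtain a where a: "a > 0" "\<And>f. f \<in> lorentz_space d \<Omega> p q \<Longrightarrow>
      weighted_rearr (lebesgue_prod d \<Omega>) (p_min d p) \<epsilon> \<kappa> (ennreal V) f \<le> ennreal a * lorentz_qnorm d \<Omega> p q f"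
    using ineq unfolding rearr_inequality_def by blast
  show ?thesis
  proof (rule that[of "a * Q * (1 / L) powr (1 / r) / (r / V) powr (1 / V)"])
    fix \<tau> assume \<tau>: "0 < \<tau>" "\<tau> \<le> \<epsilon>"
    \<comment> \<open>Here the measure is exactly \<tau>: the points t in question are strictly
      smaller, so no doubling occurs.\<close>
    define s where "s = \<tau> / L"
    have s: "0 < s" "s < c" "L * s = \<tau>"
      using \<tau> \<epsilon> L_pos mult_pos_pos[OF L_pos c_pos] by (auto simp: s_def divide_less_eq mult.commute)
    let ?f = "indicator {x \<in> S. G x < s} :: _ \<Rightarrow> real"
    let ?h = "\<lambda>t. ennreal (\<kappa> t * t powr (1 / r)) * rearrangement (lebesgue_prod d \<Omega>) ?f t"
    have "ennreal (\<kappa> \<tau> powr V * (\<tau> powr (V / r) / (V / r))) =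
        ennreal (\<kappa> \<tau> powr V) * (\<integral>\<^sup>+ t\<in>{0<..<\<tau>}. ennreal (t powr (V / r - 1)) \<partial>lborel)"
      using V r_pos \<tau> by (subst nn_integral_powr_from_0) (auto simp flip: ennreal_mult)
    also have "\<dots> = (\<integral>\<^sup>+ t. ennreal (\<kappa> \<tau> powr V) * (ennreal (t powr (V / r - 1)) * indicator {0<..<\<tau>} t) \<partial>lborel)"
      by (intro nn_integral_cmult[symmetric]) measurable
    also have "\<dots> \<le> (\<integral>\<^sup>+ t\<in>{0<..<\<epsilon>}. epowr (?h t) V * ennreal (1 / t) \<partial>lborel)"
    proof (intro nn_integral_mono)
      fix t :: real
      show "ennreal (\<kappa> \<tau> powr V) * (ennreal (t powr (V / r - 1)) * indicator {0<..<\<tau>} t) \<le>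
          epowr (?h t) V * ennreal (1 / t) * indicator {0<..<\<epsilon>} t"
      proof (cases "0 < t \<and> t < \<tau>")
        case True
        have "ennreal (\<kappa> \<tau> * t powr (1 / r)) * 1 \<le> ?h t"
          using True \<tau> s \<kappa> by (intro mult_mono ennreal_leI mult_right_mono rearrangement_indicator_level) auto
        then have "epowr (ennreal (\<kappa> \<tau> * t powr (1 / r))) V \<le> epowr (?h t) V"
          using V by (intro epowr_mono) auto
        moreover have "epowr (ennreal (\<kappa> \<tau> * t powr (1 / r))) V = ennreal (\<kappa> \<tau> powr V * t powr (V / r))"
          using \<kappa>(1)[OF \<tau>] by (simp add: epowr_ennreal powr_mult powr_powr)
        ultimately have "ennreal (\<kappa> \<tau> powr V * t powr (V / r)) * ennreal (1 / t) \<le> epowr (?h t) V * ennreal (1 / t)"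
          by (intro mult_right_mono) auto
        moreover have "ennreal (\<kappa> \<tau> powr V * t powr (V / r)) * ennreal (1 / t) =
            ennreal (\<kappa> \<tau> powr V) * ennreal (t powr (V / r - 1))"
          using True by (simp add: powr_diff flip: ennreal_mult)
        ultimately show ?thesis using True \<tau> by simp
      qed auto
    qed
    finally have "epowr (ennreal (\<kappa> \<tau> powr V * (\<tau> powr (V / r) / (V / r)))) (1 / V) \<le>
        weighted_rearr (lebesgue_prod d \<Omega>) (p_min d p) \<epsilon> \<kappa> (ennreal V) ?f"
      using V r_pos by (auto simp: weighted_rearr_def Let_def p_min_eq intro!: epowr_mono)
    also have "\<dots> \<le> ennreal a * lorentz_qnorm d \<Omega> p q ?f"
      by (intro a Q s)
    also have "\<dots> \<le> ennreal a * ennreal (Q * s powr (1 / r))"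
      by (intro mult_left_mono Q s) auto
    also have "\<dots> = ennreal (a * Q * (1 / L) powr (1 / r) * \<tau> powr (1 / r))"
      using a Q \<tau> L_pos by (simp add: s_def powr_divide mult_ac flip: ennreal_mult)
    also have "epowr (ennreal (\<kappa> \<tau> powr V * (\<tau> powr (V / r) / (V / r)))) (1 / V) =
        ennreal (\<kappa> \<tau> * (r / V) powr (1 / V) * \<tau> powr (1 / r))"
    proof -
      have "\<kappa> \<tau> powr V * (\<tau> powr (V / r) / (V / r)) = \<kappa> \<tau> powr V * \<tau> powr (V / r) * (r / V)"
        by simp
      then show ?thesis
        using \<kappa>(1)[OF \<tau>] V r_pos \<tau> by (simp add: epowr_ennreal powr_mult powr_powr mult_ac powr_divide)
    qed
    finally have "\<kappa> \<tau> * (r / V) powr (1 / V) * \<tau> powr (1 / r) \<le>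
        a * Q * (1 / L) powr (1 / r) * \<tau> powr (1 / r)"
      by (rule iffD1[OF ennreal_le_iff, rotated]) (use a Q in auto)
    then have "\<kappa> \<tau> * (r / V) powr (1 / V) \<le> a * Q * (1 / L) powr (1 / r)"
      using \<tau> by simp
    then show "\<kappa> \<tau> \<le> a * Q * (1 / L) powr (1 / r) / (r / V) powr (1 / V)"
      using V r_pos by (simp add: pos_le_divide_eq)
  qed
qed

section \<open>Truncated powers and the comparison of exponents\<close>

text \<open>The power s^(-1/r) of the level s, cut off at height \<delta>^(-1/r). It imitates the
  extremal function of weak L_r, to which all dyadic ranges of large heights contribute comparably;
  a smaller \<delta> admits more of them.\<close>

definition power_level :: "real \<Rightarrow> (nat \<Rightarrow> real) \<Rightarrow> real" where
  "power_level \<delta> x = indicator S x * max (G x) \<delta> powr (- 1 / r)"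

lemma less_powr_neg_iff:
  assumes "0 < u" "0 < m"
  shows "u < m powr (- 1 / r) \<longleftrightarrow> m < u powr (- r)"
proof
  assume "u < m powr (- 1 / r)"
  then have "(m powr (- 1 / r)) powr (- r) < u powr (- r)"
    using assms r_pos by (intro powr_less_mono2_neg) auto
  then show "m < u powr (- r)" using assms r_pos by (simp add: powr_powr)
next
  assume "m < u powr (- r)"
  then have "(u powr (- r)) powr (- 1 / r) < m powr (- 1 / r)"
    using assms r_pos by (intro powr_less_mono2_neg) auto
  then show "u < m powr (- 1 / r)" using assms r_pos by (simp add: powr_powr)
qed

lemma power_level_superlevel:
  assumes "0 < u" "0 < \<delta>"
  shows "{x \<in> prod_set d \<Omega>. \<bar>power_level \<delta> x\<bar> > u} =
    (if u < \<delta> powr (- 1 / r) then {x \<in> S. G x < u powr (- r)} else {})"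
proof -
  have "u < \<bar>power_level \<delta> x\<bar> \<longleftrightarrow> x \<in> S \<and> G x < u powr (- r) \<and> u < \<delta> powr (- 1 / r)" for x
    using less_powr_neg_iff[of u "max (G x) \<delta>"] less_powr_neg_iff[of u \<delta>] assms
    by (auto simp: power_level_def split: split_indicator)
  then show ?thesis using S_subset by auto
qed

lemma power_level_measurable: "power_level \<delta> \<in> borel_measurable (lebesgue_prod d \<Omega>)"
  unfolding power_level_def[abs_def] by measurable

text \<open>At height u the level is u^(-r), whose power 1/r is 1/u. The cap at \<open>c\<close>
  takes effect for small u, and the truncation removes all heights from \<delta>^(-1/r) on.\<close>

lemma mixed_qnorm_power_level:
  assumes "0 < u" "0 < \<delta>"
  shows "mixed_qnorm d \<Omega> p (indicator {x \<in> prod_set d \<Omega>. \<bar>power_level \<delta> x\<bar> > u}) \<le>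
    ennreal (K * min (1 / u) (c powr (1 / r))) * indicator {..<\<delta> powr (- 1 / r)} u"
proof (cases "u < \<delta> powr (- 1 / r)")
  case True
  have "min (u powr (- r)) c powr (1 / r) \<le> (u powr (- r)) powr (1 / r)"
    "min (u powr (- r)) c powr (1 / r) \<le> c powr (1 / r)"
    using r_pos c_pos by (intro powr_mono2; simp)+
  moreover have "(u powr (- r)) powr (1 / r) = 1 / u"
    using r_pos assms by (simp only: powr_powr) (simp add: powr_minus_divide)
  ultimately have "max 0 (min (u powr (- r)) c) powr (1 / r) \<le> min (1 / u) (c powr (1 / r))"
    using c_pos by (simp add: max_def)
  then have "ennreal (K * max 0 (min (u powr (- r)) c) powr (1 / r)) \<le>
      ennreal (K * min (1 / u) (c powr (1 / r)))"
    using K_pos by (intro ennreal_leI mult_left_mono) auto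
  with qnorm_level[of "u powr (- r)"] show ?thesis
    using True by (simp add: power_level_superlevel[OF assms])
next
  case False
  then show ?thesis by (simp add: power_level_superlevel[OF assms] mixed_qnorm_indicator_empty)
qed

text \<open>Between the heights c^(-1/r) and \<delta>^(-1/r) the integrand is at most K^q / u, which
  yields the logarithm ln(c/\<delta>) / r; at smaller heights the quasi-norm is bounded and the
  integral contributes the constant \<open>B\<close>. For q = \<infinity> the bound is uniform in
  \<delta>, which the exponent 0 expresses.\<close>

lemma lorentz_qnorm_power_level:
  assumes q: "0 < q"
  obtains B where "0 < B" "\<And>\<delta>. 0 < \<delta> \<Longrightarrow> \<delta> < c \<Longrightarrow> lorentz_qnorm d \<Omega> p q (power_level \<delta>) \<le>
    ennreal (K * (B + ln (c / \<delta>) / r) powr (if q = \<infinity> then 0 else 1 / enn2real q))"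
proof (cases "q = \<infinity>")
  case True
  have "lorentz_qnorm d \<Omega> p q (power_level \<delta>) \<le> ennreal (K * (1 + ln (c / \<delta>) / r) powr 0)"
    if \<delta>: "0 < \<delta>" "\<delta> < c" for \<delta>
  proof -
    \<comment> \<open>The base has to be positive: \<open>x powr 0\<close> is 1 for x > 0, whereas
      \<open>0 powr 0\<close> is 0.\<close>
    have "0 < 1 + ln (c / \<delta>) / r" using \<delta> r_pos by (intro add_pos_nonneg) auto
    moreover have "ennreal u * mixed_qnorm d \<Omega> p (indicator {x \<in> prod_set d \<Omega>. \<bar>power_level \<delta> x\<bar> > u}) \<le>
        ennreal K" if u: "0 < u" for u
    proof -
      have "ennreal u * mixed_qnorm d \<Omega> p (indicator {x \<in> prod_set d \<Omega>. \<bar>power_level \<delta> x\<bar> > u}) \<le>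
          ennreal u * (ennreal (K * min (1 / u) (c powr (1 / r))) * indicator {..<\<delta> powr (- 1 / r)} u)"
        using u \<delta> by (intro mult_left_mono mixed_qnorm_power_level) auto
      also have "\<dots> \<le> ennreal u * ennreal (K * (1 / u))"
      proof (rule mult_left_mono)
        have "K * min (1 / u) (c powr (1 / r)) \<le> K * (1 / u)"
          using K_pos by (intro mult_left_mono) auto
        from ennreal_leI[OF this]
        show "ennreal (K * min (1 / u) (c powr (1 / r))) * indicator {..<\<delta> powr (- 1 / r)} u \<le> ennreal (K * (1 / u))"
          by (simp split: split_indicator)
      qed simp
      also have "\<dots> = ennreal K"
        using u K_pos by (simp flip: ennreal_mult)
      finally show ?thesis .
    qed
    ultimately show ?thesis
      using True by (auto simp: lorentz_qnorm_eq_functional lorentz_functional_def intro!: SUP_least)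
  qed
  then show ?thesis using True by (intro that[of 1]) auto
next
  case False
  define Q where "Q = enn2real q"
  have Q: "0 < Q" using False q by (simp add: Q_def enn2real_positive_iff less_top[symmetric])
  define U where "U = c powr (- 1 / r)"
  have U: "0 < U" using c_pos by (simp add: U_def)
  have Uc: "c powr (1 / r) = 1 / U" using c_pos by (simp add: U_def powr_minus_divide)
  have "lorentz_qnorm d \<Omega> p q (power_level \<delta>) \<le>
      ennreal (K * (2 powr Q / Q + ln (c / \<delta>) / r) powr (1 / Q))" if \<delta>: "0 < \<delta>" "\<delta> < c" for \<delta>
  proof -
    define \<Lambda> where "\<Lambda> = \<delta> powr (- 1 / r)"
    have U\<Lambda>: "U < \<Lambda>" unfolding U_def \<Lambda>_def using \<delta> r_pos by (intro powr_less_mono2_neg) auto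
    let ?N = "\<lambda>u. mixed_qnorm d \<Omega> p (indicator {x \<in> prod_set d \<Omega>. \<bar>power_level \<delta> x\<bar> > u})"
    have "(\<integral>\<^sup>+ u\<in>{0<..}. ennreal (u powr Q) * epowr (?N u) Q * ennreal (1 / u) \<partial>lborel) \<le>
        (\<integral>\<^sup>+ u. ennreal (K powr Q) * (ennreal (1 / U powr Q) * (ennreal (u powr (Q - 1)) * indicator {0<..<2 * U} u) +
          ennreal (1 / u) * indicator {U<..<\<Lambda>} u) \<partial>lborel)"
    proof (intro nn_integral_mono)
      fix u :: real
      show "ennreal (u powr Q) * epowr (?N u) Q * ennreal (1 / u) * indicator {0<..} u \<le>
        ennreal (K powr Q) * (ennreal (1 / U powr Q) * (ennreal (u powr (Q - 1)) * indicator {0<..<2 * U} u) +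
          ennreal (1 / u) * indicator {U<..<\<Lambda>} u)"
      proof (cases "0 < u")
        case u: True
        note N = mixed_qnorm_power_level[OF u \<delta>(1), folded \<Lambda>_def, unfolded Uc]
        \<comment> \<open>The ranges u < 2 U and u > U overlap, so that open intervals cover the
          height U too. This is the origin of the constant 2^Q / Q.\<close>
        consider "\<Lambda> \<le> u" | "u < \<Lambda>" "u < 2 * U" | "u < \<Lambda>" "U < u" using U by linarith
        then show ?thesis
        proof cases
          case 1
          then have "?N u = 0" using N by simp
          then show ?thesis by simp
        next
          case 2
          have "ennreal (K * min (1 / u) (1 / U)) \<le> ennreal (K * (1 / U))"
            using K_pos by (intro ennreal_leI mult_left_mono) auto
          then have "epowr (?N u) Q \<le> epowr (ennreal (K * (1 / U))) Q"
            using N 2 Q by (intro epowr_mono) auto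
          also have "\<dots> = ennreal (K powr Q * (1 / U powr Q))"
            using K_pos U by (simp add: epowr_ennreal powr_mult powr_divide)
          finally have "ennreal (u powr Q) * epowr (?N u) Q * ennreal (1 / u) \<le>
              ennreal (u powr Q) * ennreal (K powr Q * (1 / U powr Q)) * ennreal (1 / u)"
            by (intro mult_right_mono mult_left_mono) auto
          also have "\<dots> = ennreal (K powr Q) * (ennreal (1 / U powr Q) * ennreal (u powr (Q - 1)))"
            using u U by (simp add: powr_diff mult_ac flip: ennreal_mult)
          finally show ?thesis using u 2 by (simp add: distrib_left add_increasing2)
        next
          case 3
          have "ennreal (K * min (1 / u) (1 / U)) \<le> ennreal (K * (1 / u))"
            using K_pos by (intro ennreal_leI mult_left_mono) auto
          then have "epowr (?N u) Q \<le> epowr (ennreal (K * (1 / u))) Q"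
            using N 3 Q by (intro epowr_mono) auto
          also have "\<dots> = ennreal (K powr Q * (1 / u powr Q))"
            using K_pos u by (simp add: epowr_ennreal powr_mult powr_divide)
          finally have "ennreal (u powr Q) * epowr (?N u) Q * ennreal (1 / u) \<le>
              ennreal (u powr Q) * ennreal (K powr Q * (1 / u powr Q)) * ennreal (1 / u)"
            by (intro mult_right_mono mult_left_mono) auto
          also have "\<dots> = ennreal (K powr Q) * ennreal (1 / u)"
            using u by (simp flip: ennreal_mult)
          finally show ?thesis using u 3 by (simp add: distrib_left add_increasing)
        qed
      qed auto
    qed
    also have "\<dots> = ennreal (K powr Q) * (ennreal (1 / U powr Q) *
        (\<integral>\<^sup>+ u\<in>{0<..<2 * U}. ennreal (u powr (Q - 1)) \<partial>lborel) +
        (\<integral>\<^sup>+ u\<in>{U<..<\<Lambda>}. ennreal (1 / u) \<partial>lborel))"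
      by (simp add: nn_integral_cmult nn_integral_add)
    also have "(\<integral>\<^sup>+ u\<in>{0<..<2 * U}. ennreal (u powr (Q - 1)) \<partial>lborel) = ennreal ((2 * U) powr Q / Q)"
      using Q U by (intro nn_integral_powr_from_0) auto
    also have "(\<integral>\<^sup>+ u\<in>{U<..<\<Lambda>}. ennreal (1 / u) \<partial>lborel) = ennreal (ln (\<Lambda> / U))"
      using U U\<Lambda> by (intro nn_integral_inverse) auto
    also have "ln (\<Lambda> / U) = ln (c / \<delta>) / r"
      using \<delta> c_pos r_pos by (simp add: \<Lambda>_def U_def ln_div ln_powr diff_divide_distrib)
    also have "ennreal (1 / U powr Q) * ennreal ((2 * U) powr Q / Q) = ennreal (2 powr Q / Q)"
      using U Q by (simp add: powr_mult flip: ennreal_mult)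
    also have "ennreal (K powr Q) * (ennreal (2 powr Q / Q) + ennreal (ln (c / \<delta>) / r)) =
        ennreal (K powr Q * (2 powr Q / Q + ln (c / \<delta>) / r))"
      using \<delta> Q r_pos by (simp flip: ennreal_plus ennreal_mult)
    finally have "lorentz_qnorm d \<Omega> p q (power_level \<delta>) \<le>
        epowr (ennreal (K powr Q * (2 powr Q / Q + ln (c / \<delta>) / r))) (1 / Q)"
      using False Q by (auto simp: lorentz_qnorm_eq_functional lorentz_functional_def Q_def[symmetric] intro!: epowr_mono)
    also have "\<dots> = ennreal (K * (2 powr Q / Q + ln (c / \<delta>) / r) powr (1 / Q))"
      using \<delta> Q r_pos K_pos by (simp add: epowr_ennreal powr_mult powr_powr)
    finally show ?thesis .
  qed
  then show ?thesis
    using False Q by (intro that[of "2 powr Q / Q"]) (auto simp: Q_def)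
qed

text \<open>The height is the value that the power takes at level 2t/L. Its superlevel set has
  measure 2t > t once this level lies above the truncation \<delta> and below \<open>c\<close>,
  which the range of t ensures.\<close>

lemma rearrangement_power_level:
  assumes "0 < \<delta>" "L * \<delta> < t" "2 * t < L * c"
  shows "ennreal ((2 * t / L) powr (- 1 / r)) \<le> rearrangement (lebesgue_prod d \<Omega>) (power_level \<delta>) t"
proof (rule rearrangement_ge[OF power_level_measurable])
  have "0 < L * \<delta>" using assms L_pos by simp
  then have "0 < t" "L * \<delta> < 2 * t" using assms(2) by linarith+
  then have t: "0 < t" "0 < 2 * t / L" "2 * t / L < c" "\<delta> < 2 * t / L"
    using assms L_pos by (auto simp: field_simps)
  have "{x \<in> prod_set d \<Omega>. (2 * t / L) powr (- 1 / r) < \<bar>power_level \<delta> x\<bar>} = {x \<in> S. G x < 2 * t / L}"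
    using t assms r_pos L_pos powr_less_mono2_neg[of "- 1 / r" \<delta> "2 * t / L"]
    by (subst power_level_superlevel) (simp_all add: powr_powr)
  then show "ennreal t < emeasure (lebesgue_prod d \<Omega>)
      {x \<in> space (lebesgue_prod d \<Omega>). (2 * t / L) powr (- 1 / r) < \<bar>power_level \<delta> x\<bar>}"
    using t L_pos by (simp add: space_lebesgue_prod emeasure_level ennreal_lessI)
qed

text \<open>On (L \<delta>, \<epsilon>) the product t^(1/r) f*(t) is at least the constant
  (L/2)^(1/r), so the integrand dominates a multiple of 1/t and the integral a logarithm.\<close>

lemma weighted_rearr_power_level_ge:
  assumes V: "0 < V" and \<epsilon>: "\<epsilon> \<le> L * c / 2" and \<delta>: "0 < \<delta>" "L * \<delta> < \<epsilon>"
    and k: "0 \<le> k" "\<And>t. 0 < t \<Longrightarrow> t < \<epsilon> \<Longrightarrow> k \<le> \<kappa> t"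
  shows "ennreal (k * (L / 2) powr (1 / r) * ln (\<epsilon> / (L * \<delta>)) powr (1 / V)) \<le>
    weighted_rearr (lebesgue_prod d \<Omega>) (p_min d p) \<epsilon> \<kappa> (ennreal V) (power_level \<delta>)"
proof -
  let ?k = "k * (L / 2) powr (1 / r)"
  let ?h = "\<lambda>t. ennreal (\<kappa> t * t powr (1 / r)) * rearrangement (lebesgue_prod d \<Omega>) (power_level \<delta>) t"
  have L\<delta>: "0 < L * \<delta>" using \<delta> L_pos by simp
  have "ennreal (?k powr V * ln (\<epsilon> / (L * \<delta>))) =
      ennreal (?k powr V) * (\<integral>\<^sup>+ t\<in>{L * \<delta><..<\<epsilon>}. ennreal (1 / t) \<partial>lborel)"
    using L\<delta> \<delta> by (subst nn_integral_inverse) (auto simp flip: ennreal_mult)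
  also have "\<dots> = (\<integral>\<^sup>+ t. ennreal (?k powr V) * (ennreal (1 / t) * indicator {L * \<delta><..<\<epsilon>} t) \<partial>lborel)"
    by (intro nn_integral_cmult[symmetric]) measurable
  also have "\<dots> \<le> (\<integral>\<^sup>+ t\<in>{0<..<\<epsilon>}. epowr (?h t) V * ennreal (1 / t) \<partial>lborel)"
  proof (intro nn_integral_mono)
    fix t :: real
    show "ennreal (?k powr V) * (ennreal (1 / t) * indicator {L * \<delta><..<\<epsilon>} t) \<le>
        epowr (?h t) V * ennreal (1 / t) * indicator {0<..<\<epsilon>} t"
    proof (cases "L * \<delta> < t \<and> t < \<epsilon>")
      case True
      then have t: "0 < t" "t < \<epsilon>" using L\<delta> by auto
      have eq: "t powr (1 / r) * (2 * t / L) powr (- 1 / r) = (L / 2) powr (1 / r)"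
        using t L_pos by (simp add: powr_minus_divide powr_divide powr_mult)
      have "ennreal ?k = ennreal (k * t powr (1 / r)) * ennreal ((2 * t / L) powr (- 1 / r))"
        using k eq by (simp add: mult.assoc flip: ennreal_mult)
      also have "\<dots> \<le> ?h t"
        using True t \<epsilon> \<delta> k by (intro mult_mono ennreal_leI mult_right_mono rearrangement_power_level) auto
      finally have "epowr (ennreal ?k) V \<le> epowr (?h t) V"
        using V by (intro epowr_mono) auto
      then have "ennreal (?k powr V) * ennreal (1 / t) \<le> epowr (?h t) V * ennreal (1 / t)"
        using k by (intro mult_right_mono) (auto simp: epowr_ennreal)
      then show ?thesis using True t by simp
    qed auto
  qed
  finally have "epowr (ennreal (?k powr V * ln (\<epsilon> / (L * \<delta>)))) (1 / V) \<le>
      weighted_rearr (lebesgue_prod d \<Omega>) (p_min d p) \<epsilon> \<kappa> (ennreal V) (power_level \<delta>)"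
    using V r_pos by (auto simp: weighted_rearr_def Let_def p_min_eq intro!: epowr_mono)
  also have "epowr (ennreal (?k powr V * ln (\<epsilon> / (L * \<delta>)))) (1 / V) =
      ennreal (?k * ln (\<epsilon> / (L * \<delta>)) powr (1 / V))"
    using V k L\<delta> \<delta> L_pos by (simp add: epowr_ennreal powr_mult powr_powr)
  finally show ?thesis .
qed

lemma exponent_le_if_rearr_inequality:
  assumes q: "0 < q" and V: "0 < V" and \<epsilon>: "0 < \<epsilon>" "\<epsilon> \<le> L * c / 2"
    and k: "0 < k" "\<And>t. 0 < t \<Longrightarrow> t < \<epsilon> \<Longrightarrow> k \<le> \<kappa> t"
    and ineq: "rearr_inequality d \<Omega> p q \<epsilon> \<kappa> (ennreal V)"
  shows "q \<le> ennreal V"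
proof (rule ccontr)
  assume "\<not> q \<le> ennreal V"
  then have Vq: "ennreal V < q" by simp
  \<comment> \<open>The value 0 stands for 1/\<infinity>, so that q = \<infinity> follows the same
    comparison of powers.\<close>
  define \<theta> where "\<theta> = (if q = \<infinity> then 0 else 1 / enn2real q)"
  have \<theta>: "0 \<le> \<theta>" "\<theta> < 1 / V"
    using Vq V by (cases q; auto simp: \<theta>_def ennreal_less_iff frac_less2)+
  obtain B where B: "0 < B" "\<And>\<delta>. 0 < \<delta> \<Longrightarrow> \<delta> < c \<Longrightarrow>
      lorentz_qnorm d \<Omega> p q (power_level \<delta>) \<le> ennreal (K * (B + ln (c / \<delta>) / r) powr \<theta>)"
    using lorentz_qnorm_power_level[OF q] unfolding \<theta>_def by blast
  obtain a where a: "a > 0" "\<And>f. f \<in> lorentz_space d \<Omega> p q \<Longrightarrow>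
      weighted_rearr (lebesgue_prod d \<Omega>) (p_min d p) \<epsilon> \<kappa> (ennreal V) f \<le> ennreal a * lorentz_qnorm d \<Omega> p q f"
    using ineq unfolding rearr_inequality_def by blast
  define k' where "k' = k * (L / 2) powr (1 / r)"
  have k': "0 < k'" using k L_pos by (simp add: k'_def)
  \<comment> \<open>\<open>B'\<close> absorbs the shift between ln(c/\<delta>) and X = ln(\<epsilon>
    / (L \<delta>)), so that both sides depend on X only.\<close>
  define B' where "B' = B + ln (c * L / \<epsilon>) / r"
  have bound: "k' * X powr (1 / V) \<le> a * K * (B' + X / r) powr \<theta>" if X: "0 < X" for X
  proof -
    define \<delta> where "\<delta> = \<epsilon> / L * exp (- X)"
    have "exp (- X) < 1" using X by simp
    then have "\<delta> < \<epsilon> / L * 1" unfolding \<delta>_def using \<epsilon> L_pos by (intro mult_strict_left_mono) auto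
    then have \<delta>: "0 < \<delta>" "L * \<delta> < \<epsilon>" "\<delta> < c"
    proof -
      have "\<epsilon> / L \<le> c / 2" using \<epsilon> L_pos by (simp add: field_simps)
      with \<open>\<delta> < \<epsilon> / L * 1\<close> c_pos show "\<delta> < c" by linarith
      show "L * \<delta> < \<epsilon>"
        using \<open>\<delta> < \<epsilon> / L * 1\<close> L_pos by (simp add: pos_less_divide_eq mult.commute)
      show "0 < \<delta>" using \<epsilon> L_pos by (simp add: \<delta>_def)
    qed
    have "\<epsilon> / (L * \<delta>) = exp X" "c / \<delta> = c * L / \<epsilon> * exp X"
      using \<epsilon> L_pos by (auto simp: \<delta>_def exp_minus field_simps)
    moreover have "ln (c * L / \<epsilon> * exp X) = ln (c * L / \<epsilon>) + X"
      using \<epsilon> L_pos c_pos by (subst ln_mult_pos) auto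
    ultimately have ln1: "ln (\<epsilon> / (L * \<delta>)) = X" and ln2: "B + ln (c / \<delta>) / r = B' + X / r"
      by (simp_all add: B'_def add_divide_distrib)
    have mem: "power_level \<delta> \<in> lorentz_space d \<Omega> p q"
      using B(2)[OF \<delta>(1,3)] power_level_measurable by (auto simp: lorentz_space_def intro: le_less_trans)
    have "ennreal (k' * X powr (1 / V)) \<le>
        weighted_rearr (lebesgue_prod d \<Omega>) (p_min d p) \<epsilon> \<kappa> (ennreal V) (power_level \<delta>)"
      using weighted_rearr_power_level_ge[OF V \<epsilon>(2) \<delta>(1,2), of k \<kappa>] k by (simp add: ln1 k'_def)
    also have "\<dots> \<le> ennreal a * lorentz_qnorm d \<Omega> p q (power_level \<delta>)"
      by (rule a(2)[OF mem])
    also have "\<dots> \<le> ennreal a * ennreal (K * (B + ln (c / \<delta>) / r) powr \<theta>)"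
      by (intro mult_left_mono B \<delta>) auto
    also have "\<dots> = ennreal (a * K * (B' + X / r) powr \<theta>)"
      using a K_pos by (simp add: ln2 mult.assoc flip: ennreal_mult)
    finally show ?thesis
      by (rule iffD1[OF ennreal_le_iff, rotated]) (use a K_pos in auto)
  qed
  define M where "M = a * K * 2 powr \<theta> / (k' * r powr (1 / V))"
  have M: "0 < M" using a K_pos k' r_pos by (simp add: M_def)
  have "0 < 1 / V - \<theta>" using \<theta> by simp
  \<comment> \<open>The bound is used at X = r Y. The first entry puts B' + Y between 0 and 2Y; the
    second makes Y^(1/V - \<theta>) at least M + 1, whereas the bound, with its constants collected
    in \<open>M\<close>, allows at most M.\<close>
  define Y where "Y = max \<bar>B'\<bar> ((M + 1) powr (1 / (1 / V - \<theta>)))"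
  have Y: "0 < Y" "B' \<le> Y" using M by (auto simp: Y_def less_max_iff_disj)
  have "k' * r powr (1 / V) * Y powr (1 / V) = k' * (r * Y) powr (1 / V)"
    using Y r_pos by (simp add: powr_mult)
  also have "\<dots> \<le> a * K * (B' + r * Y / r) powr \<theta>"
    using Y r_pos by (intro bound) auto
  also have "\<dots> \<le> a * K * (2 * Y) powr \<theta>"
  proof -
    have "\<bar>B'\<bar> \<le> Y" by (simp add: Y_def)
    then show ?thesis using r_pos a K_pos \<theta> by (intro mult_left_mono powr_mono2) auto
  qed
  also have "\<dots> = k' * r powr (1 / V) * (M * Y powr \<theta>)"
    using Y k' r_pos by (simp add: M_def powr_mult)
  finally have "Y powr (1 / V) \<le> M * Y powr \<theta>"
    using k' r_pos by simp
  then have "Y powr (1 / V - \<theta>) \<le> M"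
    using Y by (simp add: powr_diff pos_divide_le_eq)
  moreover have "M + 1 \<le> Y powr (1 / V - \<theta>)"
  proof -
    have "((M + 1) powr (1 / (1 / V - \<theta>))) powr (1 / V - \<theta>) \<le> Y powr (1 / V - \<theta>)"
      using \<open>0 < 1 / V - \<theta>\<close> by (intro powr_mono2) (auto simp: Y_def)
    moreover have "((M + 1) powr (1 / (1 / V - \<theta>))) powr (1 / V - \<theta>) = M + 1"
      using \<open>0 < 1 / V - \<theta>\<close> M by (subst powr_powr) simp
    ultimately show ?thesis by simp
  qed
  ultimately show False by simp
qed

end

section \<open>Finite factors and conclusion\<close>

lemma prod_ennreal_nonzero: "(\<And>i. i \<in> I \<Longrightarrow> f i \<noteq> 0) \<Longrightarrow> prod f I \<noteq> (0 :: ennreal)"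
  by (induction I rule: infinite_finite_induct) auto

text \<open>The embedding in one variable needs each factor to have finite measure, while finiteness
  is given for the product. As the other factors have positive measure, one infinite factor would
  make the product infinite. Borel main parts give access to the product formula.\<close>

lemma emeasure_factor_finite:
  assumes \<Omega>: "\<And>i. i < d \<Longrightarrow> \<Omega> i \<in> sets lebesgue" "\<And>i. i < d \<Longrightarrow> emeasure lebesgue (\<Omega> i) > 0"
    and fin: "emeasure (lebesgue_prod d \<Omega>) (prod_set d \<Omega>) < \<infinity>" and j: "j < d"
  shows "emeasure lebesgue (\<Omega> j) < \<infinity>"
proof -
  let ?P = "Pi\<^sub>M {..<d} (\<lambda>_. lborel :: real measure)"
  define B where "B = (\<lambda>i. main_part lborel (\<Omega> i))"
  have B: "B i \<in> sets lborel" "B i \<subseteq> \<Omega> i" "emeasure lborel (B i) = emeasure lebesgue (\<Omega> i)" if "i < d" for i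
    using \<Omega>(1)[OF that] main_part_null_part_Un[of "\<Omega> i" lborel] main_part_sets[of "\<Omega> i" lborel]
    unfolding B_def by (simp, blast, simp)
  have "Pi\<^sub>E {..<d} B \<subseteq> prod_set d \<Omega>"
    unfolding prod_set_def using B by (intro PiE_mono) auto
  then have "emeasure (completion ?P) (Pi\<^sub>E {..<d} B) \<le> emeasure (completion ?P) (prod_set d \<Omega>)"
    using prod_set_measurable[of d \<Omega>] \<Omega>(1) by (intro emeasure_mono) auto
  also have "\<dots> < top"
    using fin emeasure_lebesgue_prod[of d \<Omega>] \<Omega>(1) by simp
  also have "emeasure (completion ?P) (Pi\<^sub>E {..<d} B) = emeasure ?P (Pi\<^sub>E {..<d} B)"
    using B by (simp add: sets_PiM_I_finite)
  also have "\<dots> = (\<Prod>i<d. emeasure lebesgue (\<Omega> i))"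
    using B by (subst lborel_prod.emeasure_PiM) auto
  also have "\<dots> = emeasure lebesgue (\<Omega> j) * (\<Prod>i\<in>{..<d} - {j}. emeasure lebesgue (\<Omega> i))"
    using j by (intro prod.remove) auto
  finally have "emeasure lebesgue (\<Omega> j) * (\<Prod>i\<in>{..<d} - {j}. emeasure lebesgue (\<Omega> i)) < top" .
  moreover have "(\<Prod>i\<in>{..<d} - {j}. emeasure lebesgue (\<Omega> i)) \<noteq> 0"
    using \<Omega>(2) by (intro prod_ennreal_nonzero) force
  ultimately show ?thesis
    by (cases "emeasure lebesgue (\<Omega> j) = top") (auto simp: ennreal_top_mult less_top)
qed

theorem corollary7p2:
  fixes d :: nat and \<Omega> :: "nat \<Rightarrow> real set" and p :: "nat \<Rightarrow> ennreal" and q :: ennreal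
  assumes "d \<ge> 1"
    and "\<And>i. i < d \<Longrightarrow> \<Omega> i \<in> sets lebesgue"
    and "\<And>i. i < d \<Longrightarrow> emeasure lebesgue (\<Omega> i) > 0"
    and "emeasure (lebesgue_prod d \<Omega>) (prod_set d \<Omega>) < \<infinity>"
    and "\<And>i. i < d \<Longrightarrow> 0 < p i"
    and "p_min d p < \<infinity>"
    and "0 < q"
  shows "\<exists>\<epsilon>\<^sub>0::real. \<epsilon>\<^sub>0 > 0 \<and> (\<forall>\<epsilon>. 0 < \<epsilon> \<and> \<epsilon> \<le> \<epsilon>\<^sub>0 \<longrightarrow>
      (\<forall>(\<kappa> :: real \<Rightarrow> real) (v :: ennreal).
         (\<forall>t\<in>{0<..\<epsilon>}. \<kappa> t > 0) \<and> antimono_on {0<..\<epsilon>} \<kappa> \<and> 0 < v \<longrightarrow>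
         (rearr_inequality d \<Omega> p q \<epsilon> \<kappa> v \<longleftrightarrow> bounded (\<kappa> ` {0<..\<epsilon>}) \<and> q \<le> v)) \<and>
      (\<forall>\<kappa> :: real \<Rightarrow> real.
         (\<forall>t\<in>{0<..\<epsilon>}. \<kappa> t \<ge> 0) \<longrightarrow>
         (rearr_inequality d \<Omega> p q \<epsilon> \<kappa> \<infinity> \<longleftrightarrow> bounded (\<kappa> ` {0<..\<epsilon>}))))"
proof -
  have "p_min d p \<in> p ` {..<d}"
    unfolding p_min_def using assms(1) by (intro Min_in) (auto simp: lessThan_empty_iff)
  then have "0 < p_min d p" using assms(5) by auto
  with assms(6) obtain r where r: "p_min d p = ennreal r" "0 < r" by (cases "p_min d p") auto
  have r_le: "ennreal r \<le> p i" if "i < d" for i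
    using that unfolding r(1)[symmetric] p_min_def by (intro Min_le) auto
  have fin: "emeasure lebesgue (\<Omega> i) < \<infinity>" if "i < d" for i
    using emeasure_factor_finite[of d \<Omega>] assms(2-4) that by blast
  have sufficient: "rearr_inequality d \<Omega> p q \<epsilon> \<kappa> v"
    if bdd: "bounded (\<kappa> ` {0<..\<epsilon>})" and "q \<le> v" for \<epsilon> \<kappa> v
  proof -
    obtain B where B: "\<forall>t\<in>{0<..\<epsilon>}. \<bar>\<kappa> t\<bar> \<le> B"
      using bdd unfolding bounded_iff by auto
    have "\<kappa> t \<le> max B 1" if "0 < t" "t < \<epsilon>" for t
      using B[rule_format, of t] that by auto
    then show ?thesis
      using rearr_inequality_if_bounded[of d \<Omega> r p q v "max B 1" \<epsilon> \<kappa>] assms(2,4,7) fin r r_le \<open>q \<le> v\<close>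
      by auto
  qed
  \<comment> \<open>The inequality sees the weight on the open interval (0, \<epsilon>) only; the
    endpoint enters through \<open>max B (\<kappa> \<epsilon>)\<close>.\<close>
  have bounded: "bounded (\<kappa> ` {0<..\<epsilon>})"
    if "\<And>t. 0 < t \<Longrightarrow> t < \<epsilon> \<Longrightarrow> \<kappa> t \<le> B" "\<forall>t\<in>{0<..\<epsilon>}. 0 \<le> \<kappa> t" for \<epsilon> B and \<kappa> :: "real \<Rightarrow> real"
    unfolding bounded_iff
  proof (intro exI ballI)
    fix y assume "y \<in> \<kappa> ` {0<..\<epsilon>}"
    then obtain t where t: "y = \<kappa> t" "0 < t" "t \<le> \<epsilon>" by auto
    then show "norm y \<le> max B (\<kappa> \<epsilon>)"
      using that(1)[of t] that(2)[rule_format, of t] by (cases "t = \<epsilon>") auto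
  qed
  obtain S G L K c where "level_sets d \<Omega> p r S G L K c"
    using level_sets_exist[of d \<Omega> p r] assms r by blast
  then interpret level_sets d \<Omega> p r S G L K c .
  show ?thesis
  \<comment> \<open>The threshold leaves room for the level 2t/L below \<open>c\<close>, and it is
    fixed before the weight and \<open>v\<close>.\<close>
  proof (rule exI[of _ "L * c / 2"], intro conjI allI impI)
    show "0 < L * c / 2" using L_pos c_pos by simp
  next
    fix \<epsilon> and \<kappa> :: "real \<Rightarrow> real" and v :: ennreal
    assume \<epsilon>: "0 < \<epsilon> \<and> \<epsilon> \<le> L * c / 2"
      and \<kappa>v: "(\<forall>t\<in>{0<..\<epsilon>}. 0 < \<kappa> t) \<and> antimono_on {0<..\<epsilon>} \<kappa> \<and> 0 < v"
    then have \<kappa>: "\<And>t. 0 < t \<Longrightarrow> t \<le> \<epsilon> \<Longrightarrow> 0 < \<kappa> t"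
      "\<And>s t. 0 < s \<Longrightarrow> s \<le> t \<Longrightarrow> t \<le> \<epsilon> \<Longrightarrow> \<kappa> t \<le> \<kappa> s"
      by (auto simp: monotone_on_def)
    show "rearr_inequality d \<Omega> p q \<epsilon> \<kappa> v \<longleftrightarrow> bounded (\<kappa> ` {0<..\<epsilon>}) \<and> q \<le> v"
    proof
      assume ineq: "rearr_inequality d \<Omega> p q \<epsilon> \<kappa> v"
      show "bounded (\<kappa> ` {0<..\<epsilon>}) \<and> q \<le> v"
      proof (cases v)
        case (real V)
        then have V: "0 < V" using \<kappa>v by simp
        obtain B where B: "\<And>t. 0 < t \<Longrightarrow> t \<le> \<epsilon> \<Longrightarrow> \<kappa> t \<le> B"
          using bounded_if_rearr_inequality_integral[of q V \<epsilon> \<kappa>] assms(7) V \<epsilon> \<kappa> ineq real by blast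
        \<comment> \<open>By monotonicity \<open>\<kappa> \<epsilon>\<close> is a positive lower
          bound for the weight on (0, \<epsilon>).\<close>
        moreover have "q \<le> ennreal V"
          using \<epsilon> \<kappa> ineq real
          by (intro exponent_le_if_rearr_inequality[OF assms(7) V, of \<epsilon> "\<kappa> \<epsilon>" \<kappa>]) auto
        ultimately show ?thesis
          using bounded[of \<epsilon> \<kappa> B] \<kappa>(1) real by (auto simp: less_imp_le)
      next
        case top
        obtain B where "\<And>t. 0 < t \<Longrightarrow> t < \<epsilon> \<Longrightarrow> \<kappa> t \<le> B"
          using bounded_if_rearr_inequality_sup[of q \<epsilon> \<kappa>] assms(7) \<epsilon> \<kappa>(1) ineq top
          by (auto simp: less_imp_le)
        then show ?thesis
          using bounded[of \<epsilon> \<kappa> B] \<kappa>(1) top by (auto simp: less_imp_le)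
      qed
    qed (use sufficient in blast)
  next
    fix \<epsilon> and \<kappa> :: "real \<Rightarrow> real"
    assume \<epsilon>: "0 < \<epsilon> \<and> \<epsilon> \<le> L * c / 2" and \<kappa>: "\<forall>t\<in>{0<..\<epsilon>}. 0 \<le> \<kappa> t"
    show "rearr_inequality d \<Omega> p q \<epsilon> \<kappa> \<infinity> \<longleftrightarrow> bounded (\<kappa> ` {0<..\<epsilon>})"
    proof
      assume "rearr_inequality d \<Omega> p q \<epsilon> \<kappa> \<infinity>"
      then obtain B where "\<And>t. 0 < t \<Longrightarrow> t < \<epsilon> \<Longrightarrow> \<kappa> t \<le> B"
        using bounded_if_rearr_inequality_sup[of q \<epsilon> \<kappa>] assms(7) \<epsilon> \<kappa> by auto
      then show "bounded (\<kappa> ` {0<..\<epsilon>})" using bounded \<kappa> by blast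
    qed (use sufficient in simp)
  qed
qed

end
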